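(* Let $\mathcal{A}\in\mathbb{R}^{n_1\times n_2\times n_3\times\cdots\times n_m}$ and $\mathcal{B}\in\mathbb{R}^{n_1\times l\times n_3\times\cdots\times n_m}$ be such that $\mathcal{A}*_L\mathcal{X}=\mathcal{B}$ has a solution $\mathcal X\in\mathbb{R}^{n_2\times l\times n_3\times\cdots\times n_m}$. Let $P=\{\tau_1,\dots,\tau_M\}$ be a partition of $\{1,\dots,n_1\}$ into $M$ nonempty pairwise disjoint blocks, with $\mathcal{A}(\tau)\ne0$ for each block $\tau\in P$. Let $\lambda,\varepsilon,t>0$ and for $\mathcal{X}\in\mathbb{R}^{n_2\times l\times n_3\times\cdots\times n_m}$ let $$f(\mathcal{X})=\sum_{i_1,\dots,i_m}\lambda\log\left(1+\frac{|\mathcal{X}_{i_1,\dots,i_m}|}{\varepsilon}\right)+\frac12\|\mathcal{X}\|_F^2 ,$$ the sum being over all entries of $\mathcal{X}$. Let $\hat{\mathcal{X}}$ be the solution of $\min_{\mathcal{X}} f(\mathcal{X})$ subject to $\mathcal{A}*_L\mathcal{X}=\mathcal{B}$. Let $(\mathcal{Z}^{(k)},\mathcal{X}^{(k)})_{k\ge0}$ be generated by the block LSP regularized Kaczmarz iteration with non-overlapping blocks (described in the context), where at each iteration the block is drawn independently and uniformly at random from $P$. Let $\nu>0$ be a constant such that $$D_{f,\mathcal{Z}}(\mathcal{X},\hat{\mathcal{X}})\le\frac1\nu\|\mathcal{A}*_L(\mathcal{X}-\hat{\mathcal{X}})\|_F^2$$ for all $\mathcal{X}$ and all $\mathcal{Z}\in\partial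 f(\mathcal{X})\cap R(\mathcal{A})$ with $D_{f,\mathcal{Z}}(\mathcal{X},\hat{\mathcal{X}})\le D_{f,\mathcal{Z}^{(0)}}(\mathcal{X}^{(0)},\hat{\mathcal{X}})$. If $\sqrt{\lambda}<\varepsilon$ and $$0<\frac{\nu t}{M\|\mathcal{A}\|_F^2}\left(1-\frac{t\rho\varepsilon^2}{2\varepsilon^2-2\lambda}\right)<1,$$ then $\mathcal{X}^{(k)}$ converges linearly to $\hat{\mathcal{X}}$ in expectation via $$\mathbb{E}\|\mathcal{X}^{(k)}-\hat{\mathcal{X}}\|_F^2\le\left[\frac{2\varepsilon^2}{\varepsilon^2-\lambda}D_{f,\mathcal{Z}^{(0)}}(\mathcal{X}^{(0)},\hat{\mathcal{X}})\right]\left(1-\frac{\nu t}{M\|\mathcal{A}\|_F^2}\left(1-\frac{t\rho\varepsilon^2}{2\varepsilon^2-2\lambda}\right)\right)^k\qquad(k\ge0).$$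
   Context: Let $m\ge 3$. For invertible matrices $U_{n_i}\in\mathbb{C}^{n_i\times n_i}$, $i=3,\dots,m$, the linear transform $L$ acts on $m$-th order tensors whose last $m-2$ dimensions are $n_3,\dots,n_m$ (first two dimensions arbitrary) by $L(\mathcal{A})=\mathcal{A}\times_3U_{n_3}\times_4\cdots\times_mU_{n_m}=:\mathcal{A}_L$, where $\times_i$ is the mode-$i$ product (the mode-$i$ unfolding of $\mathcal{A}\times_iU$ is $U$ times the mode-$i$ unfolding of $\mathcal{A}$). It is assumed that there is a constant $\rho>0$ such that, with $K=U_{n_m}\otimes U_{n_{m-1}}\otimes\cdots\otimes U_{n_3}$, one has $KK^*=K^*K=\rho I$. The facewise product $\mathcal{A}\Delta\mathcal{B}$ multiplies corresponding frontal slices: $(\mathcal{A}\Delta\mathcal{B})(:,:,i_3,\dots,i_m)=\mathcal{A}(:,:,i_3,\dots,i_m)\,\mathcal{B}(:,:,i_3,\dots,i_m)$. The $L$-based t-product is $\mathcal{A}*_L\mathcal{B}=L^{-1}(\mathcal{A}_L\Delta\mathcal{B}_L)$; $L$ is such that $*_L$ maps pairs of real tensors to real tensors. The conjugate transpose $\mathcal{A}^*$ is defined by $(\mathcal{A}^* )_L(:,:,i_3,\dots,i_m)=(\mathcal{A}_L(:,:,i_3,\dots,i_m))^*$. $\langle\cdot,\cdot\rangle$ and $\|\cdot\|_F$ are the entrywise inner product and Frobenius norm. For $\tau\subset\{1,\dots,n_1\}$, $\mathcal{A}(\tau)=\mathcal{A}(\tau,:,\dots,:)$ denotes the subtensor of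 size $|\tau|\times n_2\times n_3\times\cdots\times n_m$ formed by the horizontal slices indexed by $\tau$ (similarly for $\mathcal{B}(\tau)$). The row space is $R(\mathcal{A})=\{\mathcal{A}^**_L\mathcal{Y}:\mathcal{Y}\in\mathbb{R}^{n_1\times l\times n_3\times\cdots\times n_m}\}$. $\partial f(\mathcal{X})=\{\mathcal{X}^*: f(\mathcal{Y})\ge f(\mathcal{X})+\langle\mathcal{X}^*,\mathcal{Y}-\mathcal{X}\rangle\ \forall\mathcal{Y}\}$ (here $\mathcal X^*$ denotes a subgradient). For convex $f$ and $\mathcal{Z}\in\partial f(\mathcal{X})$ the Bregman distance is $D_{f,\mathcal{Z}}(\mathcal{X},\mathcal{Y})=f(\mathcal{Y})-f(\mathcal{X})-\langle\mathcal{Z},\mathcal{Y}-\mathcal{X}\rangle$. Standing assumption: $\partial f(\hat{\mathcal{X}})\cap R(\mathcal{A})\neq\emptyset$ for the optimal solution $\hat{\mathcal{X}}$. With $\mathrm{LSP}(\mathcal{X})=\sum_{i_1,\dots,i_m}\log(1+|\mathcal{X}_{i_1,\dots,i_m}|/\varepsilon)$, define $\mathrm{prox}_{\lambda\mathrm{LSP}}(\mathcal{Z})=\operatorname{argmin}_{\mathcal{X}}\lambda\,\mathrm{LSP}(\mathcal{X})+\frac12\|\mathcal{X}-\mathcal{Z}\|_F^2$. Block LSP regularized Kaczmarz iteration: choose (deterministically) $\mathcal{Z}^{(0)}\in R(\mathcal{A})$, $\mathcal{X}^{(0)}=\mathrm{prox}_{\lambda\mathrm{LSP}}(\mathcal{Z}^{(0)})$;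 for $k=0,1,2,\dots$ choose a block $\tau(k)\in P$ and set $$\mathcal{Z}^{(k+1)}=\mathcal{Z}^{(k)}+t\,(\mathcal{A}(\tau(k)))^**_L\frac{\mathcal{B}(\tau(k))-\mathcal{A}(\tau(k))*_L\mathcal{X}^{(k)}}{\|\mathcal{A}(\tau(k))\|_F^2},\qquad \mathcal{X}^{(k+1)}=\mathrm{prox}_{\lambda\mathrm{LSP}}(\mathcal{Z}^{(k+1)}).$$ The iteration is run indefinitely (no stopping tolerance). The algorithm's parameters $\lambda,\varepsilon$ are chosen so that $(|z|+\varepsilon)^2\ge4\lambda$ for every entry $z$ of every tensor $\mathcal{Z}^{(k)}$ to which the prox is applied. *)

theory Defs
  imports
    "HOL-Probability.Probability"
    "Jordan_Normal_Form.Schur_Decomposition"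
begin

section \<open>Tensors\<close>

text \<open>A tensor is a list of mode sizes together with its entries; all indices are 0-based, so that
  list position \<open>i\<close> belongs to mode \<open>i + 1\<close>.\<close>

definition indices :: "nat list \<Rightarrow> nat list set" where
  "indices ns = {is. length is = length ns \<and> (\<forall>i<length ns. is ! i < ns ! i)}"

typedef 'a tensor = "{(ns, restrict f (indices ns)) | ns (f :: nat list \<Rightarrow> 'a). True}"
  by auto

setup_lifting type_definition_tensor

lift_definition dims :: "'a tensor \<Rightarrow> nat list" is fst .

lift_definition entry :: "'a tensor \<Rightarrow> nat list \<Rightarrow> 'a" (infixl "$$$" 100) is snd .

lift_definition tensor :: "nat list \<Rightarrow> (nat list \<Rightarrow> 'a) \<Rightarrow> 'a tensor"
  is "\<lambda>ns f. (ns, restrict f (indices ns))" by auto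

lemma dims_tensor [simp]: "dims (tensor ns f) = ns"
  by transfer simp

lemma entry_tensor [simp]: "is \<in> indices ns \<Longrightarrow> tensor ns f $$$ is = f is"
  by transfer simp

lemma tensor_eqI:
  assumes "dims A = dims B" and "\<And>is. is \<in> indices (dims A) \<Longrightarrow> A $$$ is = B $$$ is"
  shows "A = B"
  using assms by transfer (auto simp: restrict_def fun_eq_iff)

definition carrier_tensor :: "nat list \<Rightarrow> 'a tensor set" where
  "carrier_tensor ns = {A. dims A = ns}"

definition zero_tensor :: "nat list \<Rightarrow> 'a :: zero tensor" where
  "zero_tensor ns = tensor ns (\<lambda>_. 0)"

definition map_tensor :: "('a \<Rightarrow> 'b) \<Rightarrow> 'a tensor \<Rightarrow> 'b tensor" where
  "map_tensor g A = tensor (dims A) (\<lambda>is. g (A $$$ is))"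

instantiation tensor :: (plus) plus
begin
definition "A + B = tensor (dims A) (\<lambda>is. A $$$ is + B $$$ is)"
instance ..
end

instantiation tensor :: (minus) minus
begin
definition "A - B = tensor (dims A) (\<lambda>is. A $$$ is - B $$$ is)"
instance ..
end

definition smult_tensor :: "'a :: times \<Rightarrow> 'a tensor \<Rightarrow> 'a tensor" (infixr "\<cdot>\<^sub>T" 72) where
  "c \<cdot>\<^sub>T A = map_tensor ((*) c) A"

definition tinner :: "real tensor \<Rightarrow> real tensor \<Rightarrow> real" where
  "tinner A B = (\<Sum>is\<in>indices (dims A). A $$$ is * B $$$ is)"

definition fnorm :: "real tensor \<Rightarrow> real" where
  "fnorm A = sqrt (\<Sum>is\<in>indices (dims A). (A $$$ is)\<^sup>2)"

text \<open>The subtensor of the horizontal slices indexed by \<open>\<tau>\<close>, in increasing order.\<close>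

definition subtensor :: "'a tensor \<Rightarrow> nat set \<Rightarrow> 'a tensor" where
  "subtensor A \<tau> =
     tensor (card \<tau> # tl (dims A)) (\<lambda>is. A $$$ ((sorted_list_of_set \<tau> ! hd is) # tl is))"

text \<open>For \<open>is = [i\<^sub>3, \<dots>, i\<^sub>m]\<close> this is the frontal slice \<open>A(:,:,i\<^sub>3,\<dots>,i\<^sub>m)\<close>.\<close>

definition frontal :: "'a tensor \<Rightarrow> nat list \<Rightarrow> 'a mat" where
  "frontal A is = mat (dims A ! 0) (dims A ! 1) (\<lambda>(i, j). A $$$ (i # j # is))"


section \<open>The transform and the t-product\<close>

text \<open>Mode product at list position \<open>i\<close>: every mode fibre, i.e. every column of the mode
  unfolding, is multiplied by \<open>U\<close> from the left.\<close>

definition mode_prod :: "nat \<Rightarrow> 'a :: semiring_0 mat \<Rightarrow> 'a tensor \<Rightarrow> 'a tensor" where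
  "mode_prod i U A =
     tensor ((dims A)[i := dim_row U]) (\<lambda>is. \<Sum>k<dim_col U. U $$ (is ! i, k) * A $$$ (is[i := k]))"

text \<open>\<open>Us = [U\<^bsub>n\<^sub>3\<^esub>, \<dots>, U\<^bsub>n\<^sub>m\<^esub>]\<close>; its \<open>i\<close>-th element acts on list position \<open>i + 2\<close>, that is,
  on mode \<open>i + 3\<close>.\<close>

definition ltrans :: "complex mat list \<Rightarrow> complex tensor \<Rightarrow> complex tensor" where
  "ltrans Us A = fold (\<lambda>i. mode_prod (i + 2) (Us ! i)) [0..<length Us] A"

definition ltrans_inv :: "complex mat list \<Rightarrow> complex tensor \<Rightarrow> complex tensor" where
  "ltrans_inv Us A = inv_into (carrier_tensor (dims A)) (ltrans Us) A"

definition kron :: "'a :: times mat \<Rightarrow> 'a mat \<Rightarrow> 'a mat" where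
  "kron A B = mat (dim_row A * dim_row B) (dim_col A * dim_col B)
     (\<lambda>(i, j). A $$ (i div dim_row B, j div dim_col B) * B $$ (i mod dim_row B, j mod dim_col B))"

text \<open>\<open>U\<^bsub>n\<^sub>m\<^esub> \<otimes> \<dots> \<otimes> U\<^bsub>n\<^sub>3\<^esub>\<close>: later list elements are multiplied on the left.\<close>

definition kron_all :: "complex mat list \<Rightarrow> complex mat" where
  "kron_all Us = fold kron Us (1\<^sub>m 1)"

definition facewise_prod :: "complex tensor \<Rightarrow> complex tensor \<Rightarrow> complex tensor" where
  "facewise_prod A B =
     tensor (dims A ! 0 # dims B ! 1 # drop 2 (dims A))
       (\<lambda>is. (frontal A (drop 2 is) * frontal B (drop 2 is)) $$ (is ! 0, is ! 1))"

definition facewise_adjoint :: "complex tensor \<Rightarrow> complex tensor" where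
  "facewise_adjoint A =
     tensor (dims A ! 1 # dims A ! 0 # drop 2 (dims A))
       (\<lambda>is. mat_adjoint (frontal A (drop 2 is)) $$ (is ! 0, is ! 1))"

definition ctprod :: "complex mat list \<Rightarrow> complex tensor \<Rightarrow> complex tensor \<Rightarrow> complex tensor" where
  "ctprod Us A B = ltrans_inv Us (facewise_prod (ltrans Us A) (ltrans Us B))"

definition cconj_transpose :: "complex mat list \<Rightarrow> complex tensor \<Rightarrow> complex tensor" where
  "cconj_transpose Us A = ltrans_inv Us (facewise_adjoint (ltrans Us A))"

text \<open>The t-product of real tensors of compatible sizes is real.\<close>

definition real_closed :: "complex mat list \<Rightarrow> bool" where
  "real_closed Us \<longleftrightarrow>
     (\<forall>p q r (A :: real tensor) (B :: real tensor).
        A \<in> carrier_tensor (p # q # map dim_row Us) \<longrightarrow>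
        B \<in> carrier_tensor (q # r # map dim_row Us) \<longrightarrow>
        (\<forall>is\<in>indices (p # r # map dim_row Us).
           ctprod Us (map_tensor complex_of_real A) (map_tensor complex_of_real B) $$$ is \<in> \<real>))"

text \<open>The same operations on real tensors. Taking real parts only changes the type here, provided
  that \<open>real_closed Us\<close> holds and the transform is a scaled unitary map: for the product this is
  \<open>real_closed\<close> itself. For real \<open>A\<close>, the map \<open>Y \<mapsto> A\<^sup>* *\<^sub>L Y\<close> is then the adjoint of
  \<open>X \<mapsto> A *\<^sub>L X\<close> and hence also preserves real tensors, so that the imaginary part of \<open>A\<^sup>*\<close>
  annihilates all \<open>Y\<close> and is zero.\<close>

definition tprod :: "complex mat list \<Rightarrow> real tensor \<Rightarrow> real tensor \<Rightarrow> real tensor" where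
  "tprod Us A B =
     map_tensor Re (ctprod Us (map_tensor complex_of_real A) (map_tensor complex_of_real B))"

definition conj_transpose :: "complex mat list \<Rightarrow> real tensor \<Rightarrow> real tensor" where
  "conj_transpose Us A = map_tensor Re (cconj_transpose Us (map_tensor complex_of_real A))"

text \<open>The row space depends on the size \<open>l\<close> of the second mode of the coefficient tensors.\<close>

definition row_space :: "complex mat list \<Rightarrow> nat \<Rightarrow> real tensor \<Rightarrow> real tensor set" where
  "row_space Us l A =
     {tprod Us (conj_transpose Us A) Y | Y.
        Y \<in> carrier_tensor (dims A ! 0 # l # drop 2 (dims A))}"


section \<open>Subgradients, Bregman distance, and the log-sum penalty\<close>

definition subdiff :: "(real tensor \<Rightarrow> real) \<Rightarrow> real tensor \<Rightarrow> real tensor set" where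
  "subdiff f X =
     {W \<in> carrier_tensor (dims X).
        \<forall>Y\<in>carrier_tensor (dims X). f Y \<ge> f X + tinner W (Y - X)}"

definition bregman ::
  "(real tensor \<Rightarrow> real) \<Rightarrow> real tensor \<Rightarrow> real tensor \<Rightarrow> real tensor \<Rightarrow> real" where
  "bregman f Z X Y = f Y - f X - tinner Z (Y - X)"

definition lsp :: "real \<Rightarrow> real tensor \<Rightarrow> real" where
  "lsp \<epsilon> X = (\<Sum>is\<in>indices (dims X). ln (1 + \<bar>X $$$ is\<bar> / \<epsilon>))"

definition prox_lsp :: "real \<Rightarrow> real \<Rightarrow> real tensor \<Rightarrow> real tensor" where
  "prox_lsp lam \<epsilon> Z =
     arg_min (\<lambda>X. lam * lsp \<epsilon> X + 1 / 2 * (fnorm (X - Z))\<^sup>2) (\<lambda>X. X \<in> carrier_tensor (dims Z))"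

definition reg_lsp :: "real \<Rightarrow> real \<Rightarrow> real tensor \<Rightarrow> real" where
  "reg_lsp lam \<epsilon> X =
     (\<Sum>is\<in>indices (dims X). lam * ln (1 + \<bar>X $$$ is\<bar> / \<epsilon>)) + 1 / 2 * (fnorm X)\<^sup>2"

text \<open>One update of \<open>Z\<close> with step size \<open>t\<close>, the current block being \<open>\<tau>\<close>.\<close>

definition kaczmarz_step ::
  "complex mat list \<Rightarrow> real tensor \<Rightarrow> real tensor \<Rightarrow> real \<Rightarrow> nat set \<Rightarrow>
     real tensor \<Rightarrow> real tensor \<Rightarrow> real tensor" where
  "kaczmarz_step Us A B t \<tau> Z X =
     Z + t \<cdot>\<^sub>T tprod Us (conj_transpose Us (subtensor A \<tau>))
       ((1 / (fnorm (subtensor A \<tau>))\<^sup>2) \<cdot>\<^sub>T (subtensor B \<tau> - tprod Us (subtensor A \<tau>) X))"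

end

theory Submission
  imports Defs
begin

text \<open>The iteration is randomized mirror descent for the least squares residual with mirror map \<open>f\<close>, and the proof
  follows the Bregman distance \<open>D\<^sub>k\<close> from \<open>X\<^sup>(\<^sup>k\<^sup>)\<close> to the solution. Three facts carry it.

  \<^item> Although the log-sum penalty is concave on each half-line, its curvature is at least
    \<open>- \<lambda> / \<epsilon>\<^sup>2\<close>, so that \<open>f\<close> is strongly convex with modulus \<open>\<sigma> = 1 - \<lambda> / \<epsilon>\<^sup>2 > 0\<close>
    (\<open>ln_penalty_strongly_convex\<close>). The optimality condition of the proximal map says that \<open>Z\<^sup>(\<^sup>k\<^sup>)\<close> is a
    subgradient of \<open>f\<close> at \<open>X\<^sup>(\<^sup>k\<^sup>)\<close> (\<open>subdiff_prox_lsp\<close>). Hence \<open>D\<^sub>k\<close> dominates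
    \<open>\<sigma> / 2\<close> times the squared error, and changing the subgradient by \<open>G\<close> increases \<open>D\<^sub>k\<close> at most by
    \<open>\<langle>G, X - H\<rangle> + \<parallel>G\<parallel>\<^sup>2 / (2 \<sigma>)\<close>, where \<open>H\<close> is the solution (\<open>bregman_perturb_subgradient\<close>).

  \<^item> The transform multiplies all tubes of a tensor by the Kronecker product \<open>K\<close>, so it satisfies
    Parseval's identity with the factor \<open>\<rho>\<close> (\<open>ltrans_parseval\<close>). Slice by slice in the transform
    domain, this makes the product with \<open>A\<^sup>*\<close> the adjoint of the product with \<open>A\<close>
    (\<open>tprod_conj_transpose_adjoint\<close>) and bounds its squared operator norm by \<open>\<rho> \<parallel>A\<parallel>\<^sup>2\<close>
    (\<open>fnorm_tprod_conj_transpose_le\<close>). For a Kaczmarz step, \<open>\<langle>G, X - H\<rangle>\<close> is therefore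
    \<open>- t \<parallel>r\<parallel>\<^sup>2 / \<parallel>A(\<tau>)\<parallel>\<^sup>2\<close> with the block residual \<open>r\<close>, and \<open>\<parallel>G\<parallel>\<^sup>2\<close> is at most
    \<open>\<rho> t\<^sup>2 \<parallel>r\<parallel>\<^sup>2 / \<parallel>A(\<tau>)\<parallel>\<^sup>2\<close> (\<open>bregman_error_block_step\<close>).

  \<^item> Over a partition, the squared block residuals add up to the squared full residual, which the
    assumption on \<open>\<nu>\<close> bounds from below by \<open>\<nu> D\<^sub>k\<close>; the subgradients stay in the row space and the
    Bregman distance never increases, so the assumption applies at every step. The average
    over the blocks of the next Bregman distance is thus at most the current one times the claimed rate
    (\<open>sum_bregman_error_block_step\<close>).

  After \<open>k\<close> steps, everything is a function of the first \<open>k\<close> blocks, and these take each of the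
  \<open>M ^ k\<close> possible values with the same probability. Expectations are thus finite averages
  (\<open>expectation_uniform_history\<close>), to which the one-step estimate applies inductively
  (\<open>sum_fold_decay\<close>).\<close>

section \<open>Arithmetic of tensors\<close>

lemma mem_carrier_tensor [simp]: "A \<in> carrier_tensor ns \<longleftrightarrow> dims A = ns"
  by (simp add: carrier_tensor_def)

lemma dims_tensor_ops [simp]:
  "dims (A + A') = dims A" "dims (B - B') = dims B" "dims (c \<cdot>\<^sub>T C) = dims C"
  "dims (map_tensor g D) = dims D"
  by (simp_all add: plus_tensor_def minus_tensor_def smult_tensor_def map_tensor_def)

lemma entry_tensor_ops [simp]:
  "is \<in> indices (dims A) \<Longrightarrow> (A + A') $$$ is = A $$$ is + A' $$$ is"
  "is \<in> indices (dims B) \<Longrightarrow> (B - B') $$$ is = B $$$ is - B' $$$ is"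
  "is \<in> indices (dims C) \<Longrightarrow> (c \<cdot>\<^sub>T C) $$$ is = c * C $$$ is"
  "is \<in> indices (dims D) \<Longrightarrow> map_tensor g D $$$ is = g (D $$$ is)"
  by (simp_all add: plus_tensor_def minus_tensor_def smult_tensor_def map_tensor_def)

lemma fnorm_squared: "(fnorm A)\<^sup>2 = (\<Sum>is\<in>indices (dims A). (A $$$ is)\<^sup>2)"
  by (simp add: fnorm_def sum_nonneg)

lemma fnorm_squared_smult: "(fnorm (c \<cdot>\<^sub>T A))\<^sup>2 = c\<^sup>2 * (fnorm A)\<^sup>2"
  by (simp add: fnorm_squared sum_distrib_left power_mult_distrib)

lemma tinner_smult_left: "tinner (c \<cdot>\<^sub>T A) B = c * tinner A B"
  by (simp add: tinner_def sum_distrib_left mult.assoc)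

lemma indices_Nil: "indices [] = {[]}"
  by (auto simp: indices_def)

lemma Cons_in_indices [simp]: "i # is \<in> indices (n # ns) \<longleftrightarrow> i < n \<and> is \<in> indices ns"
  by (auto simp: indices_def All_less_Suc2)

lemma indices_Cons: "indices (n # ns) = (\<lambda>(i, is). i # is) ` ({..<n} \<times> indices ns)"
proof (intro equalityI subsetI)
  fix "is" assume is_in: "is \<in> indices (n # ns)"
  then obtain i is' where "is = i # is'"
    by (cases "is") (auto simp: indices_def)
  with is_in show "is \<in> (\<lambda>(i, is). i # is) ` ({..<n} \<times> indices ns)"
    by auto
qed auto

lemma finite_indices [simp]: "finite (indices ns)"
  by (induction ns) (simp_all add: indices_Nil indices_Cons)

lemma sum_indices_Cons:
  "(\<Sum>is\<in>indices (n # ns). g is) = (\<Sum>i<n. \<Sum>is\<in>indices ns. g (i # is))"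
proof -
  have "inj_on (\<lambda>(i, is). i # is) ({..<n} \<times> indices ns)"
    by (auto simp: inj_on_def)
  then show ?thesis
    by (simp add: indices_Cons sum.reindex sum.cartesian_product case_prod_unfold)
qed

section \<open>Strong convexity of the regularized log-sum penalty\<close>

text \<open>The second derivative of the function is \<open>1 - 1 / (1 + u)\<^sup>2\<close>: the quadratic term is exactly
  strong enough to outweigh the concavity of the logarithm at \<open>u = 0\<close>, where it is largest.\<close>

lemma convex_on_ln_plus_half_square: "convex_on {0..} (\<lambda>u :: real. ln (1 + u) + u\<^sup>2 / 2)"
proof (rule f''_ge0_imp_convex)
  fix u :: real assume "u \<in> {0..}"
  then have u: "u \<ge> 0" by simp
  show "((\<lambda>u. ln (1 + u) + u\<^sup>2 / 2) has_real_derivative 1 / (1 + u) + u) (at u)"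
    using u by (auto intro!: derivative_eq_intros)
  show "((\<lambda>u. 1 / (1 + u) + u) has_real_derivative 1 - 1 / (1 + u)\<^sup>2) (at u)"
    using u by (auto intro!: derivative_eq_intros simp: power2_eq_square)
  show "0 \<le> 1 - 1 / (1 + u)\<^sup>2"
    using u by (simp add: divide_simps power2_eq_square algebra_simps)
qed simp

lemma ln_abs_plus_square_convex:
  fixes x y s \<epsilon> :: real
  assumes "\<epsilon> > 0" "0 \<le> s" "s \<le> 1"
  defines "g \<equiv> \<lambda>x. ln (1 + \<bar>x\<bar> / \<epsilon>) + x\<^sup>2 / (2 * \<epsilon>\<^sup>2)"
  shows "g ((1 - s) * x + s * y) \<le> (1 - s) * g x + s * g y"
proof -
  define h where "h = (\<lambda>u :: real. ln (1 + u) + u\<^sup>2 / 2)"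
  have g_h: "g x = h (\<bar>x\<bar> / \<epsilon>)" for x
    by (simp add: g_def h_def power_divide)
  \<comment> \<open>As \<open>h\<close> is increasing, its convexity carries over to the composition with the convex
    function \<open>\<bar>\<cdot>\<bar>\<close>.\<close>
  have mono: "h u \<le> h v" if "0 \<le> u" "u \<le> v" for u v
    using that by (auto simp: h_def intro!: add_mono power_mono)
  have "\<bar>(1 - s) * x + s * y\<bar> \<le> (1 - s) * \<bar>x\<bar> + s * \<bar>y\<bar>"
    using assms(2,3) abs_triangle_ineq[of "(1 - s) * x" "s * y"] by (simp add: abs_mult)
  then have "\<bar>(1 - s) * x + s * y\<bar> / \<epsilon> \<le> (1 - s) * (\<bar>x\<bar> / \<epsilon>) + s * (\<bar>y\<bar> / \<epsilon>)"
    using \<open>\<epsilon> > 0\<close> by (simp add: field_simps)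
  then have "g ((1 - s) * x + s * y) \<le> h ((1 - s) * (\<bar>x\<bar> / \<epsilon>) + s * (\<bar>y\<bar> / \<epsilon>))"
    unfolding g_h using \<open>\<epsilon> > 0\<close> by (intro mono) auto
  also have "\<dots> \<le> (1 - s) * h (\<bar>x\<bar> / \<epsilon>) + s * h (\<bar>y\<bar> / \<epsilon>)"
    using convex_onD[OF convex_on_ln_plus_half_square, of s "\<bar>x\<bar> / \<epsilon>" "\<bar>y\<bar> / \<epsilon>"] assms
    by (simp add: h_def)
  finally show ?thesis by (simp add: g_h)
qed

lemma ln_penalty_strongly_convex:
  fixes x y s lam \<epsilon> :: real
  assumes "lam \<ge> 0" "\<epsilon> > 0" "0 \<le> s" "s \<le> 1"
  defines "\<phi> \<equiv> \<lambda>x. lam * ln (1 + \<bar>x\<bar> / \<epsilon>) + 1 / 2 * x\<^sup>2"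
  shows "\<phi> ((1 - s) * x + s * y)
    \<le> (1 - s) * \<phi> x + s * \<phi> y - (1 - lam / \<epsilon>\<^sup>2) / 2 * s * (1 - s) * (y - x)\<^sup>2"
proof -
  define g where "g = (\<lambda>x. ln (1 + \<bar>x\<bar> / \<epsilon>) + x\<^sup>2 / (2 * \<epsilon>\<^sup>2))"
  have \<phi>_g: "\<phi> x = lam * g x + (1 - lam / \<epsilon>\<^sup>2) / 2 * x\<^sup>2" for x
    using \<open>\<epsilon> > 0\<close> by (simp add: \<phi>_def g_def field_simps)
  have "g ((1 - s) * x + s * y) \<le> (1 - s) * g x + s * g y"
    unfolding g_def by (rule ln_abs_plus_square_convex) (use assms in auto)
  then have "lam * g ((1 - s) * x + s * y) \<le> lam * ((1 - s) * g x + s * g y)"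
    using \<open>lam \<ge> 0\<close> by (intro mult_left_mono)
  moreover define c where "c = (1 - lam / \<epsilon>\<^sup>2) / 2"
  moreover have "c * ((1 - s) * x + s * y)\<^sup>2
      = (1 - s) * (c * x\<^sup>2) + s * (c * y\<^sup>2) - c * s * (1 - s) * (y - x)\<^sup>2"
    by (simp add: algebra_simps power2_eq_square)
  ultimately show ?thesis
    unfolding \<phi>_g c_def[symmetric] by (simp add: algebra_simps)
qed

lemma reg_lsp_altdef:
  "reg_lsp lam \<epsilon> X
    = (\<Sum>is\<in>indices (dims X). lam * ln (1 + \<bar>X $$$ is\<bar> / \<epsilon>) + 1 / 2 * (X $$$ is)\<^sup>2)"
  by (simp add: reg_lsp_def fnorm_squared sum.distrib sum_distrib_left)

text \<open>A subgradient of a strongly convex function minorizes it with a quadratic gain. The subgradient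
  inequality at the point \<open>(1 - s) X + s Y\<close> is combined with strong convexity on the segment; the
  terms in \<open>s\<close> that remain vanish as \<open>s\<close> tends to \<open>0\<close>.\<close>

lemma reg_lsp_subgradient_quadratic:
  assumes "lam \<ge> 0" "\<epsilon> > 0"
    and W: "W \<in> subdiff (reg_lsp lam \<epsilon>) X" and Y: "dims Y = dims X"
  shows "reg_lsp lam \<epsilon> X + tinner W (Y - X) + (1 - lam / \<epsilon>\<^sup>2) / 2 * (fnorm (Y - X))\<^sup>2
    \<le> reg_lsp lam \<epsilon> Y"
proof -
  let ?f = "reg_lsp lam \<epsilon>" and ?\<sigma> = "1 - lam / \<epsilon>\<^sup>2"
  have dW: "dims W = dims X"
    using W by (simp add: subdiff_def)
  have "?\<sigma> / 2 * (fnorm (Y - X))\<^sup>2 \<le> ?f Y - ?f X - tinner W (Y - X)"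
  proof (rule field_le_mult_one_interval)
    fix r :: real assume r: "0 < r" "r < 1"
    define s where "s = 1 - r"
    then have s: "0 < s" "s < 1" using r by auto
    define V where "V = tensor (dims X) (\<lambda>is. (1 - s) * X $$$ is + s * Y $$$ is)"
    have "?f V \<le> (\<Sum>is\<in>indices (dims X).
        (1 - s) * (lam * ln (1 + \<bar>X $$$ is\<bar> / \<epsilon>) + 1 / 2 * (X $$$ is)\<^sup>2)
        + s * (lam * ln (1 + \<bar>Y $$$ is\<bar> / \<epsilon>) + 1 / 2 * (Y $$$ is)\<^sup>2)
        - ?\<sigma> / 2 * s * (1 - s) * (Y $$$ is - X $$$ is)\<^sup>2)"
      unfolding reg_lsp_altdef V_def dims_tensor
    proof (rule sum_mono)
      fix "is" assume "is \<in> indices (dims X)"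
      then show "lam * ln (1 + \<bar>tensor (dims X) (\<lambda>is. (1 - s) * X $$$ is + s * Y $$$ is) $$$ is\<bar> / \<epsilon>)
          + 1 / 2 * (tensor (dims X) (\<lambda>is. (1 - s) * X $$$ is + s * Y $$$ is) $$$ is)\<^sup>2
        \<le> (1 - s) * (lam * ln (1 + \<bar>X $$$ is\<bar> / \<epsilon>) + 1 / 2 * (X $$$ is)\<^sup>2)
          + s * (lam * ln (1 + \<bar>Y $$$ is\<bar> / \<epsilon>) + 1 / 2 * (Y $$$ is)\<^sup>2)
          - ?\<sigma> / 2 * s * (1 - s) * (Y $$$ is - X $$$ is)\<^sup>2"
        using ln_penalty_strongly_convex[of lam \<epsilon> s "X $$$ is" "Y $$$ is"] assms s by simp
    qed
    also have "\<dots> = (1 - s) * ?f X + s * ?f Y - ?\<sigma> / 2 * s * (1 - s) * (fnorm (Y - X))\<^sup>2"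
      by (simp only: reg_lsp_altdef fnorm_squared Y dims_tensor_ops sum_distrib_left
          flip: sum_subtractf sum.distrib)
        (rule sum.cong, simp_all add: Y)
    finally have "?f V \<le> (1 - s) * ?f X + s * ?f Y - ?\<sigma> / 2 * s * (1 - s) * (fnorm (Y - X))\<^sup>2" .
    moreover have "?f X + tinner W (V - X) \<le> ?f V"
      using W by (simp add: subdiff_def V_def)
    moreover have "tinner W (V - X) = s * tinner W (Y - X)"
      by (simp add: tinner_def dW Y V_def sum_distrib_left algebra_simps)
    \<comment> \<open>Dividing by \<open>s\<close> leaves the factor \<open>r = 1 - s\<close>, which may be any number in the open unit
      interval.\<close>
    ultimately have "s * (r * (?\<sigma> / 2 * (fnorm (Y - X))\<^sup>2)) \<le> s * (?f Y - ?f X - tinner W (Y - X))"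
      by (simp add: s_def algebra_simps)
    then show "r * (?\<sigma> / 2 * (fnorm (Y - X))\<^sup>2) \<le> ?f Y - ?f X - tinner W (Y - X)"
      using s by (simp only: mult_le_cancel_left_pos)
  qed
  then show ?thesis by linarith
qed

text \<open>This turns the decay of the Bregman distance into a bound for the error of the iterates.\<close>

lemma bregman_reg_lsp_ge:
  assumes "lam \<ge> 0" "\<epsilon> > 0" "W \<in> subdiff (reg_lsp lam \<epsilon>) X" "dims Y = dims X"
  shows "(1 - lam / \<epsilon>\<^sup>2) / 2 * (fnorm (Y - X))\<^sup>2 \<le> bregman (reg_lsp lam \<epsilon>) W X Y"
  using reg_lsp_subgradient_quadratic[OF assms] unfolding bregman_def by linarith

text \<open>If \<open>W\<close> and \<open>W + G\<close> are subgradients of a \<open>\<sigma>\<close>-strongly convex \<open>f\<close> at \<open>X\<close> and \<open>X'\<close>, then the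
  left-hand side is \<open>f\<^sup>*(W + G) - \<langle>W + G, H\<rangle> + f H\<close> with the convex conjugate \<open>f\<^sup>*\<close>, and the bound
  expresses that the gradient of \<open>f\<^sup>*\<close>, whose value at \<open>W\<close> is \<open>X\<close>, has Lipschitz constant
  \<open>1 / \<sigma>\<close>. The direct proof rests on
  \<open>\<langle>G, X' - X\<rangle> \<le> \<parallel>G\<parallel>\<^sup>2 / (2 \<sigma>) + \<sigma> / 2 \<parallel>X' - X\<parallel>\<^sup>2\<close>.\<close>

lemma bregman_perturb_subgradient:
  assumes dims: "dims W = ds" "dims G = ds" "dims X = ds" "dims X' = ds" "dims H = ds"
    and "\<sigma> > 0"
    and strong: "f X + tinner W (X' - X) + \<sigma> / 2 * (fnorm (X' - X))\<^sup>2 \<le> f X'"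
  shows "bregman f (W + G) X' H
    \<le> bregman f W X H + tinner G (X - H) + 1 / (2 * \<sigma>) * (fnorm G)\<^sup>2"
proof -
  have pointwise: "w * (h - x) - (w + g) * (h - x') - w * (x' - x) - \<sigma> / 2 * (x' - x)\<^sup>2
      \<le> g * (x - h) + 1 / (2 * \<sigma>) * g\<^sup>2" for w g x x' h :: real
  proof -
    have "0 \<le> (g - \<sigma> * (x' - x))\<^sup>2 / (2 * \<sigma>)"
      using \<open>\<sigma> > 0\<close> by simp
    also have "\<dots> = g * (x - h) + 1 / (2 * \<sigma>) * g\<^sup>2
        - (w * (h - x) - (w + g) * (h - x') - w * (x' - x) - \<sigma> / 2 * (x' - x)\<^sup>2)"
      using \<open>\<sigma> > 0\<close> by (simp add: field_simps power2_eq_square)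
    finally show ?thesis by simp
  qed
  have "tinner W (H - X) - tinner (W + G) (H - X') - tinner W (X' - X) - \<sigma> / 2 * (fnorm (X' - X))\<^sup>2
      = (\<Sum>is\<in>indices ds. W $$$ is * (H $$$ is - X $$$ is)
          - (W $$$ is + G $$$ is) * (H $$$ is - X' $$$ is) - W $$$ is * (X' $$$ is - X $$$ is)
          - \<sigma> / 2 * (X' $$$ is - X $$$ is)\<^sup>2)"
    by (simp only: tinner_def fnorm_squared sum_subtractf sum_distrib_left)
      (simp add: dims)
  also have "\<dots> \<le> (\<Sum>is\<in>indices ds. G $$$ is * (X $$$ is - H $$$ is) + 1 / (2 * \<sigma>) * (G $$$ is)\<^sup>2)"
    by (intro sum_mono pointwise)
  also have "\<dots> = tinner G (X - H) + 1 / (2 * \<sigma>) * (fnorm G)\<^sup>2"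
    by (simp only: tinner_def fnorm_squared sum.distrib sum_distrib_left) (simp add: dims)
  finally show ?thesis
    using strong by (simp add: bregman_def)
qed

section \<open>The proximal map selects a subgradient\<close>

lemma ln_penalty_prox_exists:
  fixes z lam \<epsilon> :: real
  assumes "lam \<ge> 0" "\<epsilon> > 0"
  shows "\<exists>x. \<forall>y. lam * ln (1 + \<bar>x\<bar> / \<epsilon>) + 1 / 2 * (x - z)\<^sup>2
    \<le> lam * ln (1 + \<bar>y\<bar> / \<epsilon>) + 1 / 2 * (y - z)\<^sup>2"
proof -
  define g where "g y = lam * ln (1 + \<bar>y\<bar> / \<epsilon>) + 1 / 2 * (y - z)\<^sup>2" for y
  have pos: "0 < 1 + \<bar>y\<bar> / \<epsilon>" for y
    using \<open>\<epsilon> > 0\<close> by (simp add: add_pos_nonneg)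
  have quadratic_le_g: "1 / 2 * (y - z)\<^sup>2 \<le> g y" for y
    using assms by (simp add: g_def)
  have gz: "g z \<ge> 0"
    using quadratic_le_g[of z] by simp
  have ne: "{z - (g z + 1)..z + (g z + 1)} \<noteq> {}"
    using gz by simp
  have cont: "continuous_on {z - (g z + 1)..z + (g z + 1)} g"
    unfolding g_def using \<open>\<epsilon> > 0\<close>
    by (intro continuous_intros ballI less_imp_neq[OF pos, symmetric]) simp
  then obtain x where x: "\<And>y. y \<in> {z - (g z + 1)..z + (g z + 1)} \<Longrightarrow> g x \<le> g y"
    using continuous_attains_inf[OF compact_Icc ne cont] by blast
  have "g x \<le> g y" for y
  proof (cases "y \<in> {z - (g z + 1)..z + (g z + 1)}")
    case False
    \<comment> \<open>Outside the interval, the quadratic part alone exceeds the value at the centre.\<close>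
    then have "(g z + 1)\<^sup>2 \<le> \<bar>y - z\<bar>\<^sup>2"
      using gz by (intro power_mono) auto
    moreover have "2 * g z \<le> (g z + 1)\<^sup>2"
      by (simp add: power2_eq_square algebra_simps)
    ultimately have "g z \<le> g y"
      using quadratic_le_g[of y] by simp
    then show ?thesis
      using x[of z] gz by simp
  qed (rule x)
  then show ?thesis unfolding g_def by blast
qed

lemma prox_lsp_objective_altdef:
  assumes "dims X = dims Z"
  shows "lam * lsp \<epsilon> X + 1 / 2 * (fnorm (X - Z))\<^sup>2
    = (\<Sum>is\<in>indices (dims Z). lam * ln (1 + \<bar>X $$$ is\<bar> / \<epsilon>) + 1 / 2 * (X $$$ is - Z $$$ is)\<^sup>2)"
  by (simp add: lsp_def fnorm_squared sum.distrib sum_distrib_left assms)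

lemma is_arg_min_prox_lsp:
  assumes "lam \<ge> 0" "\<epsilon> > 0"
  shows "is_arg_min (\<lambda>X. lam * lsp \<epsilon> X + 1 / 2 * (fnorm (X - Z))\<^sup>2)
    (\<lambda>X. X \<in> carrier_tensor (dims Z)) (prox_lsp lam \<epsilon> Z)"
proof -
  obtain p where p: "\<And>z y. lam * ln (1 + \<bar>p z\<bar> / \<epsilon>) + 1 / 2 * (p z - z)\<^sup>2
      \<le> lam * ln (1 + \<bar>y\<bar> / \<epsilon>) + 1 / 2 * (y - z)\<^sup>2"
    using ln_penalty_prox_exists[OF assms] by metis
  let ?obj = "\<lambda>X. lam * lsp \<epsilon> X + 1 / 2 * (fnorm (X - Z))\<^sup>2"
  have "?obj (map_tensor p Z) \<le> ?obj Y" if "dims Y = dims Z" for Y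
    unfolding prox_lsp_objective_altdef[OF that]
      prox_lsp_objective_altdef[of "map_tensor p Z" Z, OF dims_tensor_ops(4)]
    by (rule sum_mono) (use p in simp)
  then have "is_arg_min ?obj (\<lambda>X. X \<in> carrier_tensor (dims Z)) (map_tensor p Z)"
    by (simp add: is_arg_min_linorder)
  then show ?thesis
    unfolding prox_lsp_def arg_min_def by (rule someI)
qed

lemma dims_prox_lsp [simp]:
  assumes "lam \<ge> 0" "\<epsilon> > 0"
  shows "dims (prox_lsp lam \<epsilon> Z) = dims Z"
  using is_arg_min_prox_lsp[OF assms, of Z] by (simp add: is_arg_min_def)

text \<open>Expanding the square shows that the proximal map minimizes \<open>X \<mapsto> f X - \<langle>Z, X\<rangle>\<close>, and a
  minimizer of this function is a point at which \<open>Z\<close> is a subgradient.\<close>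

lemma subdiff_prox_lsp:
  assumes "lam \<ge> 0" "\<epsilon> > 0"
  shows "Z \<in> subdiff (reg_lsp lam \<epsilon>) (prox_lsp lam \<epsilon> Z)"
proof -
  let ?X = "prox_lsp lam \<epsilon> Z"
  have expand: "lam * lsp \<epsilon> Y + 1 / 2 * (fnorm (Y - Z))\<^sup>2
      = reg_lsp lam \<epsilon> Y - (\<Sum>is\<in>indices (dims Z). Z $$$ is * Y $$$ is) + 1 / 2 * (fnorm Z)\<^sup>2"
    if "dims Y = dims Z" for Y
    unfolding prox_lsp_objective_altdef[OF that] reg_lsp_altdef fnorm_squared[of Z] that
      sum_distrib_left sum_subtractf[symmetric] sum.distrib[symmetric]
    by (rule sum.cong) (simp_all add: power2_eq_square field_simps)
  have "reg_lsp lam \<epsilon> ?X + tinner Z (Y - ?X) \<le> reg_lsp lam \<epsilon> Y" if Y: "dims Y = dims Z" for Y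
  proof -
    have "lam * lsp \<epsilon> ?X + 1 / 2 * (fnorm (?X - Z))\<^sup>2 \<le> lam * lsp \<epsilon> Y + 1 / 2 * (fnorm (Y - Z))\<^sup>2"
      using is_arg_min_prox_lsp[OF assms, of Z] Y by (simp add: is_arg_min_linorder)
    moreover have "tinner Z (Y - ?X)
        = (\<Sum>is\<in>indices (dims Z). Z $$$ is * Y $$$ is) - (\<Sum>is\<in>indices (dims Z). Z $$$ is * ?X $$$ is)"
      by (simp add: tinner_def Y right_diff_distrib sum_subtractf)
    ultimately show ?thesis
      unfolding expand[OF Y] expand[OF dims_prox_lsp[OF assms]] by linarith
  qed
  then show ?thesis
    using assms by (simp add: subdiff_def)
qed

section \<open>The Kronecker product indexed by multi-indices\<close>

lemma sum_indices_snoc: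
  "(\<Sum>is\<in>indices (ns @ [n]). g is) = (\<Sum>i<n. \<Sum>is\<in>indices ns. g (is @ [i]))"
proof (induction ns arbitrary: g)
  case Nil
  then show ?case by (simp add: sum_indices_Cons indices_Nil)
next
  case (Cons m ns)
  have "(\<Sum>is\<in>indices ((m # ns) @ [n]). g is) = (\<Sum>j<m. \<Sum>i<n. \<Sum>is\<in>indices ns. g (j # is @ [i]))"
    by (simp add: sum_indices_Cons Cons)
  also have "\<dots> = (\<Sum>i<n. \<Sum>j<m. \<Sum>is\<in>indices ns. g (j # is @ [i]))"
    by (rule sum.swap)
  finally show ?case by (simp add: sum_indices_Cons)
qed

lemma snoc_in_indices:
  "is \<in> indices (ns @ [n]) \<longleftrightarrow> (\<exists>is' i. is = is' @ [i] \<and> is' \<in> indices ns \<and> i < n)"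
proof
  assume is_in: "is \<in> indices (ns @ [n])"
  then obtain is' i where "is": "is = is' @ [i]"
    by (cases "is" rule: rev_exhaust) (auto simp: indices_def)
  with is_in show "\<exists>is' i. is = is' @ [i] \<and> is' \<in> indices ns \<and> i < n"
    by (auto simp: indices_def nth_append All_less_Suc split: if_splits)
qed (auto simp: indices_def nth_append All_less_Suc)

text \<open>The position of a multi-index in the ordering that underlies the Kronecker product
  \<open>U\<^bsub>n\<^sub>m\<^esub> \<otimes> \<dots> \<otimes> U\<^bsub>n\<^sub>3\<^esub>\<close>: the first index varies fastest.\<close>

definition linear_index :: "nat list \<Rightarrow> nat list \<Rightarrow> nat" where
  "linear_index ns is = (\<Sum>k<length ns. is ! k * prod_list (take k ns))"

lemma linear_index_snoc:
  assumes "is \<in> indices ns"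
  shows "linear_index (ns @ [n]) (is @ [i]) = linear_index ns is + i * prod_list ns"
  using assms by (simp add: linear_index_def indices_def nth_append)

lemma div_mod_mixed_radix:
  fixes a i N :: nat
  assumes "a < N"
  shows "(a + i * N) div N = i" "(a + i * N) mod N = a"
  using assms by simp_all

lemma linear_index_less:
  assumes "is \<in> indices ns"
  shows "linear_index ns is < prod_list ns"
  using assms
proof (induction ns arbitrary: "is" rule: rev_induct)
  case Nil
  then show ?case by (simp add: linear_index_def)
next
  case (snoc n ns)
  then obtain is' i where idx: "is = is' @ [i]" "is' \<in> indices ns" "i < n"
    by (auto simp: snoc_in_indices)
  have "linear_index ns is' + i * prod_list ns < Suc i * prod_list ns"
    using snoc.IH[OF idx(2)] by simp
  also have "\<dots> \<le> n * prod_list ns"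
    using idx(3) by (intro mult_right_mono) auto
  finally show ?case using idx by (simp add: linear_index_snoc mult.commute)
qed

lemma linear_index_inj:
  assumes "is \<in> indices ns" "js \<in> indices ns" "linear_index ns is = linear_index ns js"
  shows "is = js"
  using assms
proof (induction ns arbitrary: "is" js rule: rev_induct)
  case Nil
  then show ?case by (simp add: indices_Nil)
next
  case (snoc n ns)
  then obtain is' i js' j where *: "is = is' @ [i]" "is' \<in> indices ns" "js = js' @ [j]" "js' \<in> indices ns"
    by (auto simp: snoc_in_indices)
  let ?N = "prod_list ns"
  have eq: "linear_index ns is' + i * ?N = linear_index ns js' + j * ?N"
    using snoc.prems(3) * by (simp add: linear_index_snoc)
  have less: "linear_index ns is' < ?N" "linear_index ns js' < ?N"
    using * linear_index_less by auto
  have "linear_index ns is' = linear_index ns js'"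
    using arg_cong[OF eq, of "\<lambda>a. a mod ?N"] unfolding div_mod_mixed_radix[OF less(1)]
      div_mod_mixed_radix[OF less(2)] .
  moreover have "i = j"
    using arg_cong[OF eq, of "\<lambda>a. a div ?N"] unfolding div_mod_mixed_radix[OF less(1)]
      div_mod_mixed_radix[OF less(2)] .
  ultimately show ?case
    using snoc.IH * by blast
qed

lemma sum_linear_index:
  "(\<Sum>is\<in>indices ns. g (linear_index ns is)) = (\<Sum>a<prod_list ns. g a)"
proof (induction ns arbitrary: g rule: rev_induct)
  case Nil
  then show ?case by (simp add: indices_Nil linear_index_def)
next
  case (snoc n ns)
  let ?N = "prod_list ns"
  have "(\<Sum>is\<in>indices (ns @ [n]). g (linear_index (ns @ [n]) is))
      = (\<Sum>i<n. \<Sum>is\<in>indices ns. g (linear_index ns is + i * ?N))"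
    by (simp add: sum_indices_snoc linear_index_snoc)
  also have "\<dots> = (\<Sum>i<n. sum g {i * ?N..<i * ?N + ?N})"
  proof (rule sum.cong[OF refl])
    fix i
    have "(\<Sum>is\<in>indices ns. g (linear_index ns is + i * ?N)) = (\<Sum>a<?N. g (a + i * ?N))"
      by (rule snoc.IH)
    also have "\<dots> = sum g {0 + i * ?N..<?N + i * ?N}"
      unfolding sum.shift_bounds_nat_ivl by (simp add: lessThan_atLeast0)
    finally show "(\<Sum>is\<in>indices ns. g (linear_index ns is + i * ?N)) = sum g {i * ?N..<i * ?N + ?N}"
      by (simp add: add.commute)
  qed
  also have "\<dots> = (\<Sum>a<n * ?N. g a)"
    by (rule sum.nat_group)
  finally show ?case by (simp add: mult.commute)
qed

definition kron_entry :: "complex mat list \<Rightarrow> nat list \<Rightarrow> nat list \<Rightarrow> complex" where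
  "kron_entry Us hs is = (\<Prod>k<length Us. Us ! k $$ (hs ! k, is ! k))"

lemma kron_all_snoc: "kron_all (Us @ [U]) = kron U (kron_all Us)"
  by (simp add: kron_all_def)

lemma kron_all_entry:
  assumes "list_all2 (\<lambda>U n. U \<in> carrier_mat n n) Us ns"
  shows "kron_all Us \<in> carrier_mat (prod_list ns) (prod_list ns)"
    and "\<lbrakk>hs \<in> indices ns; is \<in> indices ns\<rbrakk> \<Longrightarrow>
      kron_all Us $$ (linear_index ns hs, linear_index ns is) = kron_entry Us hs is"
  using assms
proof (induction Us arbitrary: ns hs "is" rule: rev_induct)
  case Nil
  {
    case 1
    then show ?case by (simp add: kron_all_def)
  next
    case 2
    then show ?case by (simp add: kron_all_def linear_index_def kron_entry_def)
  }
next
  case (snoc U Us)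
  {
    case 1
    then obtain ns' n where ns: "ns = ns' @ [n]" "list_all2 (\<lambda>U n. U \<in> carrier_mat n n) Us ns'"
      "U \<in> carrier_mat n n"
      by (auto simp: list_all2_append1 list_all2_Cons1)
    then show ?case
      using snoc.IH(1)[OF ns(2)] by (simp add: kron_all_snoc kron_def mult.commute)
  next
    case 2
    then obtain ns' n where ns: "ns = ns' @ [n]" "list_all2 (\<lambda>U n. U \<in> carrier_mat n n) Us ns'"
      "U \<in> carrier_mat n n"
      by (auto simp: list_all2_append1 list_all2_Cons1)
    from 2 ns obtain hs' h is' i where idx: "hs = hs' @ [h]" "hs' \<in> indices ns'" "h < n"
      "is = is' @ [i]" "is' \<in> indices ns'" "i < n"
      by (auto simp: snoc_in_indices)
    let ?N = "prod_list ns'"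
    have len: "length Us = length ns'" "length hs' = length ns'" "length is' = length ns'"
      using ns idx by (auto simp: indices_def list_all2_lengthD)
    have less: "linear_index ns' hs' < ?N" "linear_index ns' is' < ?N"
      using idx linear_index_less by auto
    have lin_less: "linear_index ns hs < n * ?N" "linear_index ns is < n * ?N"
      using linear_index_less[OF "2"(1)] linear_index_less[OF "2"(2)] ns by (simp_all add: mult.commute)
    have "kron_all (Us @ [U]) $$ (linear_index ns hs, linear_index ns is)
        = U $$ (h, i) * kron_all Us $$ (linear_index ns' hs', linear_index ns' is')"
      using snoc.IH(1)[OF ns(2)] lin_less less ns idx
      by (simp add: kron_all_snoc kron_def linear_index_snoc div_mod_mixed_radix)
    then show ?case
      using snoc.IH(2)[OF idx(2,5) ns(2)] len by (simp add: kron_entry_def idx nth_append mult.commute)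
  }
qed

lemma index_mat_adjoint:
  assumes "i < dim_col A" "j < dim_row A"
  shows "mat_adjoint A $$ (i, j) = conjugate (A $$ (j, i))"
  using assms by (simp add: mat_adjoint_def mat_of_rows_index)

lemma dim_mat_adjoint [simp]:
  "dim_row (mat_adjoint A) = dim_col A" "dim_col (mat_adjoint A) = dim_row A"
  by (simp_all add: mat_adjoint_def)

section \<open>The transform\<close>

locale scaled_unitary_transform =
  fixes Us :: "complex mat list" and ns :: "nat list" and \<rho> :: real
  assumes length_Us: "length Us = length ns"
    and Us_carrier: "\<forall>i<length ns. Us ! i \<in> carrier_mat (ns ! i) (ns ! i)"
    and rho_pos: "\<rho> > 0"
    and kron_mult_adjoint:
      "kron_all Us * mat_adjoint (kron_all Us) = of_real \<rho> \<cdot>\<^sub>m 1\<^sub>m (prod_list ns)"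
    and adjoint_mult_kron:
      "mat_adjoint (kron_all Us) * kron_all Us = of_real \<rho> \<cdot>\<^sub>m 1\<^sub>m (prod_list ns)"
begin

lemma list_all2_Us: "list_all2 (\<lambda>U n. U \<in> carrier_mat n n) Us ns"
  using length_Us Us_carrier by (simp add: list_all2_conv_all_nth)

lemma kron_all_carrier: "kron_all Us \<in> carrier_mat (prod_list ns) (prod_list ns)"
  by (rule kron_all_entry(1)[OF list_all2_Us])

lemma kron_entry_rows_orthogonal:
  assumes "hs \<in> indices ns" "hs' \<in> indices ns"
  shows "(\<Sum>is\<in>indices ns. kron_entry Us hs is * cnj (kron_entry Us hs' is))
    = (if hs = hs' then of_real \<rho> else 0)"
proof -
  let ?K = "kron_all Us" and ?N = "prod_list ns" and ?a = "linear_index ns hs" and ?b = "linear_index ns hs'"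
  have K: "dim_row ?K = ?N" "dim_col ?K = ?N"
    using kron_all_carrier by auto
  have ab: "?a < ?N" "?b < ?N"
    using assms by (auto intro: linear_index_less)
  have "(\<Sum>is\<in>indices ns. kron_entry Us hs is * cnj (kron_entry Us hs' is))
      = (\<Sum>is\<in>indices ns. ?K $$ (?a, linear_index ns is) * cnj (?K $$ (?b, linear_index ns is)))"
    using assms by (simp add: kron_all_entry(2)[OF list_all2_Us])
  also have "\<dots> = (\<Sum>c<?N. ?K $$ (?a, c) * cnj (?K $$ (?b, c)))"
    by (rule sum_linear_index[of "\<lambda>c. ?K $$ (?a, c) * cnj (?K $$ (?b, c))"])
  also have "\<dots> = (?K * mat_adjoint ?K) $$ (?a, ?b)"
    using ab by (simp add: K scalar_prod_def index_mat_adjoint lessThan_atLeast0)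
  also have "\<dots> = (if ?a = ?b then of_real \<rho> else 0)"
    using ab by (simp add: kron_mult_adjoint)
  also have "?a = ?b \<longleftrightarrow> hs = hs'"
    using assms linear_index_inj by blast
  finally show ?thesis .
qed

lemma kron_entry_cols_orthogonal:
  assumes "is \<in> indices ns" "is' \<in> indices ns"
  shows "(\<Sum>hs\<in>indices ns. cnj (kron_entry Us hs is) * kron_entry Us hs is')
    = (if is = is' then of_real \<rho> else 0)"
proof -
  let ?K = "kron_all Us" and ?N = "prod_list ns" and ?a = "linear_index ns is" and ?b = "linear_index ns is'"
  have K: "dim_row ?K = ?N" "dim_col ?K = ?N"
    using kron_all_carrier by auto
  have ab: "?a < ?N" "?b < ?N"
    using assms by (auto intro: linear_index_less)
  have "(\<Sum>hs\<in>indices ns. cnj (kron_entry Us hs is) * kron_entry Us hs is')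
      = (\<Sum>hs\<in>indices ns. cnj (?K $$ (linear_index ns hs, ?a)) * ?K $$ (linear_index ns hs, ?b))"
    using assms by (simp add: kron_all_entry(2)[OF list_all2_Us])
  also have "\<dots> = (\<Sum>c<?N. cnj (?K $$ (c, ?a)) * ?K $$ (c, ?b))"
    by (rule sum_linear_index[of "\<lambda>c. cnj (?K $$ (c, ?a)) * ?K $$ (c, ?b)"])
  also have "\<dots> = (mat_adjoint ?K * ?K) $$ (?a, ?b)"
    using ab by (simp add: K scalar_prod_def index_mat_adjoint lessThan_atLeast0)
  also have "\<dots> = (if ?a = ?b then of_real \<rho> else 0)"
    using ab by (simp add: adjoint_mult_kron)
  also have "?a = ?b \<longleftrightarrow> is = is'"
    using assms linear_index_inj by blast
  finally show ?thesis .
qed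

text \<open>The transform acts on every tube \<open>is \<mapsto> A(i, j, is)\<close> by the same matrix, the Kronecker
  product.\<close>

definition tube_trans :: "(nat list \<Rightarrow> complex) \<Rightarrow> nat list \<Rightarrow> complex" where
  "tube_trans a hs = (\<Sum>is\<in>indices ns. kron_entry Us hs is * a is)"

definition tube_inv :: "(nat list \<Rightarrow> complex) \<Rightarrow> nat list \<Rightarrow> complex" where
  "tube_inv b is = 1 / of_real \<rho> * (\<Sum>hs\<in>indices ns. cnj (kron_entry Us hs is) * b hs)"

lemma tube_trans_cong: "(\<And>is. is \<in> indices ns \<Longrightarrow> a is = b is) \<Longrightarrow> tube_trans a hs = tube_trans b hs"
  by (simp add: tube_trans_def)

lemma tube_inv_cong: "(\<And>hs. hs \<in> indices ns \<Longrightarrow> a hs = b hs) \<Longrightarrow> tube_inv a is = tube_inv b is"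
  by (simp add: tube_inv_def)

lemma tube_trans_linear: "tube_trans (\<lambda>is. a is + c * b is) hs = tube_trans a hs + c * tube_trans b hs"
  by (simp add: tube_trans_def sum.distrib sum_distrib_left algebra_simps)

lemma tube_inv_linear: "tube_inv (\<lambda>hs. a hs + c * b hs) is = tube_inv a is + c * tube_inv b is"
  by (simp add: tube_inv_def sum.distrib sum_distrib_left algebra_simps)

lemma tube_inv_trans:
  assumes "is \<in> indices ns"
  shows "tube_inv (tube_trans a) is = a is"
proof -
  have "(\<Sum>hs\<in>indices ns. cnj (kron_entry Us hs is) * tube_trans a hs)
      = (\<Sum>is'\<in>indices ns. (\<Sum>hs\<in>indices ns. cnj (kron_entry Us hs is) * kron_entry Us hs is') * a is')"
    unfolding tube_trans_def sum_distrib_left sum_distrib_right mult.assoc[symmetric] by (rule sum.swap)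
  also have "\<dots> = (\<Sum>is'\<in>indices ns. if is = is' then of_real \<rho> * a is' else 0)"
    using assms by (intro sum.cong) (simp_all add: kron_entry_cols_orthogonal)
  also have "\<dots> = of_real \<rho> * a is"
    using assms by simp
  finally show ?thesis
    using rho_pos by (simp add: tube_inv_def)
qed

lemma tube_trans_inv:
  assumes "hs \<in> indices ns"
  shows "tube_trans (tube_inv b) hs = b hs"
proof -
  have "(\<Sum>is\<in>indices ns. kron_entry Us hs is * (\<Sum>hs'\<in>indices ns. cnj (kron_entry Us hs' is) * b hs'))
      = (\<Sum>hs'\<in>indices ns. (\<Sum>is\<in>indices ns. kron_entry Us hs is * cnj (kron_entry Us hs' is)) * b hs')"
    unfolding sum_distrib_left sum_distrib_right mult.assoc[symmetric] by (rule sum.swap)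
  also have "\<dots> = (\<Sum>hs'\<in>indices ns. if hs = hs' then of_real \<rho> * b hs' else 0)"
    using assms by (intro sum.cong) (simp_all add: kron_entry_rows_orthogonal)
  also have "\<dots> = of_real \<rho> * b hs"
    using assms by simp
  finally have "(\<Sum>is\<in>indices ns. kron_entry Us hs is
      * (\<Sum>hs'\<in>indices ns. cnj (kron_entry Us hs' is) * b hs')) = of_real \<rho> * b hs" .
  moreover have "tube_trans (tube_inv b) hs = 1 / of_real \<rho> * (\<Sum>is\<in>indices ns. kron_entry Us hs is
      * (\<Sum>hs'\<in>indices ns. cnj (kron_entry Us hs' is) * b hs'))"
    unfolding tube_trans_def tube_inv_def sum_distrib_left by (simp add: mult.left_commute)
  ultimately show ?thesis
    using rho_pos by simp
qed

lemma tube_parseval: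
  "(\<Sum>hs\<in>indices ns. tube_trans a hs * cnj (tube_trans b hs)) = of_real \<rho> * (\<Sum>is\<in>indices ns. a is * cnj (b is))"
proof -
  have "(\<Sum>hs\<in>indices ns. tube_trans a hs * cnj (tube_trans b hs))
      = (\<Sum>hs\<in>indices ns. \<Sum>is\<in>indices ns. cnj (b is) * (cnj (kron_entry Us hs is) * tube_trans a hs))"
    unfolding tube_trans_def[of b] by (simp add: sum_distrib_left mult_ac)
  also have "\<dots> = (\<Sum>is\<in>indices ns. cnj (b is) * (\<Sum>hs\<in>indices ns. cnj (kron_entry Us hs is) * tube_trans a hs))"
    unfolding sum_distrib_left by (rule sum.swap)
  also have "\<dots> = (\<Sum>is\<in>indices ns. cnj (b is) * (of_real \<rho> * tube_inv (tube_trans a) is))"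
    using rho_pos by (simp add: tube_inv_def)
  also have "\<dots> = of_real \<rho> * (\<Sum>is\<in>indices ns. a is * cnj (b is))"
    unfolding sum_distrib_left by (intro sum.cong) (simp_all add: tube_inv_trans mult_ac)
  finally show ?thesis .
qed

text \<open>After \<open>n\<close> mode products, the first \<open>n\<close> indices of each tube have been transformed and the others
  are still the original ones.\<close>

lemma partial_ltrans:
  assumes A: "dims A = p # q # ns" and "n \<le> length ns"
  defines "F \<equiv> \<lambda>n. fold (\<lambda>i. mode_prod (i + 2) (Us ! i)) [0..<n] A"
  shows "dims (F n) = dims A"
    and "\<And>i j hs. \<lbrakk>i < p; j < q; hs \<in> indices ns\<rbrakk> \<Longrightarrow>
      F n $$$ (i # j # hs)
        = (\<Sum>is\<in>indices (take n ns). (\<Prod>k<n. Us ! k $$ (hs ! k, is ! k)) * A $$$ (i # j # is @ drop n hs))"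
  using \<open>n \<le> length ns\<close>
proof (induction n)
  case 0
  {
    case 1
    show ?case by (simp add: F_def)
  next
    case 2
    then show ?case by (simp add: F_def indices_Nil)
  }
next
  case (Suc n)
  have U: "Us ! n \<in> carrier_mat (ns ! n) (ns ! n)" if "n < length ns"
    using Us_carrier that by auto
  have F_Suc: "F (Suc n) = mode_prod (n + 2) (Us ! n) (F n)"
    by (simp add: F_def)
  have take_Suc: "take (Suc n) ns = take n ns @ [ns ! n]" if "n < length ns"
    using that by (rule take_Suc_conv_app_nth)
  {
    case 1
    then show ?case
      using Suc.IH(1) U A by (simp add: F_Suc mode_prod_def)
  next
    case (2 i j hs)
    note U = U[OF Suc_le_lessD[OF 2(4)]]
    from 2 have len: "n < length ns" "length hs = length ns"
      by (auto simp: indices_def)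
    have IH_dims: "dims (F n) = p # q # ns"
      using Suc.IH(1) 2 A by simp
    have upd: "hs[n := k] \<in> indices ns" if "k < ns ! n" for k
      using 2 that by (auto simp: indices_def nth_list_update)
    have drop_upd: "drop n (hs[n := k]) = k # drop (Suc n) hs" for k
      using len by (simp add: drop_update_swap Cons_nth_drop_Suc[symmetric])
    have "F (Suc n) $$$ (i # j # hs)
        = (\<Sum>k<ns ! n. Us ! n $$ (hs ! n, k) * F n $$$ (i # j # hs[n := k]))"
      using U 2 IH_dims by (simp add: F_Suc mode_prod_def)
    also have "\<dots> = (\<Sum>k<ns ! n. \<Sum>is\<in>indices (take n ns).
        (\<Prod>k'<Suc n. Us ! k' $$ (hs ! k', (is @ [k]) ! k')) * A $$$ (i # j # (is @ [k]) @ drop (Suc n) hs))"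
    proof (rule sum.cong[OF refl])
      fix k assume "k \<in> {..<ns ! n}"
      then have "F n $$$ (i # j # hs[n := k]) = (\<Sum>is\<in>indices (take n ns).
          (\<Prod>k'<n. Us ! k' $$ (hs[n := k] ! k', is ! k')) * A $$$ (i # j # is @ drop n (hs[n := k])))"
        using Suc.IH(2)[of i j "hs[n := k]"] 2 upd by simp
      also have "\<dots> = (\<Sum>is\<in>indices (take n ns).
          (\<Prod>k'<n. Us ! k' $$ (hs ! k', (is @ [k]) ! k')) * A $$$ (i # j # (is @ [k]) @ drop (Suc n) hs))"
        using len by (intro sum.cong) (auto simp: drop_upd indices_def nth_append intro!: prod.cong)
      finally show "Us ! n $$ (hs ! n, k) * F n $$$ (i # j # hs[n := k]) = (\<Sum>is\<in>indices (take n ns).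
          (\<Prod>k'<Suc n. Us ! k' $$ (hs ! k', (is @ [k]) ! k')) * A $$$ (i # j # (is @ [k]) @ drop (Suc n) hs))"
        unfolding sum_distrib_left using len
        by (simp add: sum_distrib_left) (intro sum.cong, auto simp: indices_def nth_append)
    qed
    finally show ?case
      by (simp only: take_Suc[OF len(1)] sum_indices_snoc)
  }
qed

lemma dims_ltrans:
  assumes "dims A = p # q # ns"
  shows "dims (ltrans Us A) = p # q # ns"
  using partial_ltrans(1)[OF assms order_refl] assms by (simp add: ltrans_def length_Us)

lemma ltrans_entry:
  assumes "dims A = p # q # ns" "i < p" "j < q" "hs \<in> indices ns"
  shows "ltrans Us A $$$ (i # j # hs) = tube_trans (\<lambda>is. A $$$ (i # j # is)) hs"
  using partial_ltrans(2)[OF assms(1) order_refl assms(2-4)] assms(4)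
  by (simp add: ltrans_def length_Us tube_trans_def kron_entry_def indices_def)

lemma tensor3_eqI:
  assumes "dims A = p # q # ns" "dims B = p # q # ns"
    and "\<And>i j is. \<lbrakk>i < p; j < q; is \<in> indices ns\<rbrakk> \<Longrightarrow> A $$$ (i # j # is) = B $$$ (i # j # is)"
  shows "A = B"
  by (rule tensor_eqI) (use assms in \<open>auto simp: indices_Cons\<close>)

lemma bij_betw_ltrans:
  "bij_betw (ltrans Us) (carrier_tensor (p # q # ns)) (carrier_tensor (p # q # ns))"
proof -
  define inverse where
    "inverse A = tensor (dims A) (\<lambda>is. tube_inv (\<lambda>hs. A $$$ (is ! 0 # is ! 1 # hs)) (drop 2 is))"
    for A :: "complex tensor"
  have inverse_entry: "inverse A $$$ (i # j # is) = tube_inv (\<lambda>hs. A $$$ (i # j # hs)) is"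
    if "dims A = p # q # ns" "i < p" "j < q" "is \<in> indices ns" for A i j "is"
    using that by (simp add: inverse_def)
  have dims_inverse [simp]: "dims (inverse A) = dims A" for A
    by (simp add: inverse_def)
  have left: "inverse (ltrans Us A) = A" if A: "dims A = p # q # ns" for A
    by (rule tensor3_eqI)
      (auto simp: A dims_ltrans inverse_entry ltrans_entry[OF A] tube_inv_trans cong: tube_inv_cong)
  have right: "ltrans Us (inverse A) = A" if A: "dims A = p # q # ns" for A
  proof (rule tensor3_eqI)
    fix i j "is" assume "i < p" "j < q" "is \<in> indices ns"
    then show "ltrans Us (inverse A) $$$ (i # j # is) = A $$$ (i # j # is)"
      by (simp add: A ltrans_entry[of _ p q] inverse_entry tube_trans_inv cong: tube_trans_cong)
  qed (auto simp: A dims_ltrans)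
  show ?thesis
    by (rule bij_betw_byWitness[where f' = inverse]) (auto simp: left right dims_ltrans)
qed

lemma ltrans_inv_right:
  assumes "dims A = p # q # ns"
  shows "ltrans Us (ltrans_inv Us A) = A"
  using bij_betw_inv_into_right[OF bij_betw_ltrans[of p q], of A] assms by (simp add: ltrans_inv_def)

lemma dims_ltrans_inv:
  assumes "dims A = p # q # ns"
  shows "dims (ltrans_inv Us A) = p # q # ns"
  using bij_betwE[OF bij_betw_inv_into[OF bij_betw_ltrans[of p q]]] assms by (simp add: ltrans_inv_def)

lemma ltrans_inv_entry:
  assumes A: "dims A = p # q # ns" and "i < p" "j < q" "is \<in> indices ns"
  shows "ltrans_inv Us A $$$ (i # j # is) = tube_inv (\<lambda>hs. A $$$ (i # j # hs)) is"
proof -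
  have "tube_inv (\<lambda>hs. A $$$ (i # j # hs)) is
      = tube_inv (tube_trans (\<lambda>is. ltrans_inv Us A $$$ (i # j # is))) is"
    by (intro tube_inv_cong)
      (metis ltrans_entry[OF dims_ltrans_inv[OF A] assms(2,3)] ltrans_inv_right[OF A])
  then show ?thesis
    using assms by (simp add: tube_inv_trans)
qed

lemma ltrans_parseval:
  assumes A: "dims A = p # q # ns" and B: "dims B = p # q # ns"
  shows "(\<Sum>is\<in>indices (p # q # ns). ltrans Us A $$$ is * cnj (ltrans Us B $$$ is))
    = of_real \<rho> * (\<Sum>is\<in>indices (p # q # ns). A $$$ is * cnj (B $$$ is))"
  by (simp add: sum_indices_Cons ltrans_entry[OF A] ltrans_entry[OF B] tube_parseval sum_distrib_left)

end

section \<open>The t-product in the transform domain\<close>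

abbreviation cplx :: "real tensor \<Rightarrow> complex tensor" where
  "cplx \<equiv> map_tensor complex_of_real"

definition cfnorm2 :: "complex tensor \<Rightarrow> real" where
  "cfnorm2 A = (\<Sum>is\<in>indices (dims A). (cmod (A $$$ is))\<^sup>2)"

lemma cfnorm2_cplx: "cfnorm2 (cplx A) = (fnorm A)\<^sup>2"
  by (simp add: cfnorm2_def fnorm_squared)

lemma frontal_mult_entry:
  assumes "dims A = p # q # ns" "dims B = q # r # ns" "i < p" "j < r"
  shows "(frontal A hs * frontal B hs) $$ (i, j) = (\<Sum>k<q. A $$$ (i # k # hs) * B $$$ (k # j # hs))"
  using assms by (simp add: frontal_def scalar_prod_def lessThan_atLeast0)

context scaled_unitary_transform
begin

context
  fixes p q r :: nat and A B :: "complex tensor"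
  assumes A: "dims A = p # q # ns" and B: "dims B = q # r # ns"
begin

lemma dims_facewise_prod_ltrans:
  "dims (facewise_prod (ltrans Us A) (ltrans Us B)) = p # r # ns"
  by (simp add: facewise_prod_def dims_ltrans[OF A] dims_ltrans[OF B])

lemma facewise_prod_ltrans_entry:
  assumes "i < p" "j < r" "hs \<in> indices ns"
  shows "facewise_prod (ltrans Us A) (ltrans Us B) $$$ (i # j # hs)
    = (\<Sum>k<q. ltrans Us A $$$ (i # k # hs) * ltrans Us B $$$ (k # j # hs))"
  using assms
  by (simp add: facewise_prod_def dims_ltrans[OF A] dims_ltrans[OF B]
      frontal_mult_entry[OF dims_ltrans[OF A] dims_ltrans[OF B]])

lemma dims_ctprod: "dims (ctprod Us A B) = p # r # ns"
  unfolding ctprod_def by (rule dims_ltrans_inv[OF dims_facewise_prod_ltrans])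

lemma ltrans_ctprod_entry:
  assumes "i < p" "j < r" "hs \<in> indices ns"
  shows "ltrans Us (ctprod Us A B) $$$ (i # j # hs)
    = (\<Sum>k<q. ltrans Us A $$$ (i # k # hs) * ltrans Us B $$$ (k # j # hs))"
  unfolding ctprod_def ltrans_inv_right[OF dims_facewise_prod_ltrans]
  by (rule facewise_prod_ltrans_entry[OF assms])

lemma ctprod_entry:
  assumes "i < p" "j < r" "is \<in> indices ns"
  shows "ctprod Us A B $$$ (i # j # is) = tube_inv (\<lambda>hs. \<Sum>k<q.
    tube_trans (\<lambda>is. A $$$ (i # k # is)) hs * tube_trans (\<lambda>is. B $$$ (k # j # is)) hs) is"
  unfolding ctprod_def ltrans_inv_entry[OF dims_facewise_prod_ltrans assms]
  using assms
  by (intro tube_inv_cong) (simp add: facewise_prod_ltrans_entry ltrans_entry[OF A] ltrans_entry[OF B])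

end

lemma ctprod_add_smult_left:
  assumes A: "dims A = p # q # ns" and A': "dims A' = p # q # ns" and B: "dims B = q # r # ns"
  shows "ctprod Us (A + c \<cdot>\<^sub>T A') B = ctprod Us A B + c \<cdot>\<^sub>T ctprod Us A' B"
proof (rule tensor3_eqI)
  have AA: "dims (A + c \<cdot>\<^sub>T A') = p # q # ns"
    using A by simp
  show "dims (ctprod Us (A + c \<cdot>\<^sub>T A') B) = p # r # ns"
    by (rule dims_ctprod[OF AA B])
  show "dims (ctprod Us A B + c \<cdot>\<^sub>T ctprod Us A' B) = p # r # ns"
    by (simp add: dims_ctprod[OF A B])
  fix i j "is" assume *: "i < p" "j < r" "is \<in> indices ns"
  have "tube_trans (\<lambda>is. (A + c \<cdot>\<^sub>T A') $$$ (i # k # is)) hs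
      = tube_trans (\<lambda>is. A $$$ (i # k # is)) hs + c * tube_trans (\<lambda>is. A' $$$ (i # k # is)) hs"
    if "k < q" for k hs
    unfolding tube_trans_linear[symmetric]
    by (rule tube_trans_cong) (use * that in \<open>simp add: A A'\<close>)
  then show "ctprod Us (A + c \<cdot>\<^sub>T A') B $$$ (i # j # is)
      = (ctprod Us A B + c \<cdot>\<^sub>T ctprod Us A' B) $$$ (i # j # is)"
    using * by (simp add: ctprod_entry[OF AA B] ctprod_entry[OF A B] ctprod_entry[OF A' B]
      dims_ctprod[OF A B] dims_ctprod[OF A' B] distrib_right sum.distrib mult.assoc
      sum_distrib_left[symmetric] tube_inv_linear)
qed

lemma ctprod_add_smult_right:
  assumes A: "dims A = p # q # ns" and B: "dims B = q # r # ns" and B': "dims B' = q # r # ns"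
  shows "ctprod Us A (B + c \<cdot>\<^sub>T B') = ctprod Us A B + c \<cdot>\<^sub>T ctprod Us A B'"
proof (rule tensor3_eqI)
  have BB: "dims (B + c \<cdot>\<^sub>T B') = q # r # ns"
    using B by simp
  show "dims (ctprod Us A (B + c \<cdot>\<^sub>T B')) = p # r # ns"
    by (rule dims_ctprod[OF A BB])
  show "dims (ctprod Us A B + c \<cdot>\<^sub>T ctprod Us A B') = p # r # ns"
    by (simp add: dims_ctprod[OF A B])
  fix i j "is" assume *: "i < p" "j < r" "is \<in> indices ns"
  have "tube_trans (\<lambda>is. (B + c \<cdot>\<^sub>T B') $$$ (k # j # is)) hs
      = tube_trans (\<lambda>is. B $$$ (k # j # is)) hs + c * tube_trans (\<lambda>is. B' $$$ (k # j # is)) hs"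
    if "k < q" for k hs
    unfolding tube_trans_linear[symmetric]
    by (rule tube_trans_cong) (use * that in \<open>simp add: B B'\<close>)
  then show "ctprod Us A (B + c \<cdot>\<^sub>T B') $$$ (i # j # is)
      = (ctprod Us A B + c \<cdot>\<^sub>T ctprod Us A B') $$$ (i # j # is)"
    using * by (simp add: ctprod_entry[OF A BB] ctprod_entry[OF A B] ctprod_entry[OF A B']
      dims_ctprod[OF A B] dims_ctprod[OF A B'] distrib_left sum.distrib mult.left_commute[of _ c]
      sum_distrib_left[symmetric] tube_inv_linear)
qed

lemma dims_facewise_adjoint_ltrans:
  assumes A: "dims A = p # q # ns"
  shows "dims (facewise_adjoint (ltrans Us A)) = q # p # ns"
  by (simp add: facewise_adjoint_def dims_ltrans[OF A])

lemma dims_cconj_transpose: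
  assumes A: "dims A = p # q # ns"
  shows "dims (cconj_transpose Us A) = q # p # ns"
  unfolding cconj_transpose_def by (rule dims_ltrans_inv[OF dims_facewise_adjoint_ltrans[OF A]])

lemma ltrans_cconj_transpose_entry:
  assumes A: "dims A = p # q # ns" and "k < q" "i < p" "hs \<in> indices ns"
  shows "ltrans Us (cconj_transpose Us A) $$$ (k # i # hs) = cnj (ltrans Us A $$$ (i # k # hs))"
  unfolding cconj_transpose_def ltrans_inv_right[OF dims_facewise_adjoint_ltrans[OF A]]
  using assms by (simp add: facewise_adjoint_def dims_ltrans[OF A] index_mat_adjoint frontal_def)

text \<open>By Parseval's identity it suffices to compare the two sides in the transform domain, where they
  are sums of inner products of matrices, slice by slice.\<close>

lemma ctprod_cconj_transpose_adjoint:
  assumes A: "dims A = p # q # ns" and Y: "dims Y = p # r # ns" and X: "dims X = q # r # ns"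
  shows "(\<Sum>is\<in>indices (q # r # ns). ctprod Us (cconj_transpose Us A) Y $$$ is * cnj (X $$$ is))
    = (\<Sum>is\<in>indices (p # r # ns). Y $$$ is * cnj (ctprod Us A X $$$ is))"
proof -
  let ?C = "cconj_transpose Us A"
  note C = dims_cconj_transpose[OF A]
  let ?t = "\<lambda>i k j h. cnj (ltrans Us A $$$ (i # k # h)) * ltrans Us Y $$$ (i # j # h)
    * cnj (ltrans Us X $$$ (k # j # h))"
  have "of_real \<rho> * (\<Sum>is\<in>indices (q # r # ns). ctprod Us ?C Y $$$ is * cnj (X $$$ is))
      = (\<Sum>is\<in>indices (q # r # ns). ltrans Us (ctprod Us ?C Y) $$$ is * cnj (ltrans Us X $$$ is))"
    by (rule ltrans_parseval[symmetric, OF dims_ctprod[OF C Y] X])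
  also have "\<dots> = (\<Sum>k<q. \<Sum>j<r. \<Sum>h\<in>indices ns. \<Sum>i<p. ?t i k j h)"
    by (simp add: sum_indices_Cons ltrans_ctprod_entry[OF C Y] ltrans_cconj_transpose_entry[OF A]
      sum_distrib_right)
  also have "\<dots> = (\<Sum>j<r. \<Sum>k<q. \<Sum>h\<in>indices ns. \<Sum>i<p. ?t i k j h)"
    by (rule sum.swap)
  also have "\<dots> = (\<Sum>j<r. \<Sum>h\<in>indices ns. \<Sum>k<q. \<Sum>i<p. ?t i k j h)"
    by (intro sum.cong refl) (rule sum.swap)
  also have "\<dots> = (\<Sum>j<r. \<Sum>h\<in>indices ns. \<Sum>i<p. \<Sum>k<q. ?t i k j h)"
    by (rule sum.cong[OF refl], rule sum.cong[OF refl], rule sum.swap)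
  also have "\<dots> = (\<Sum>j<r. \<Sum>i<p. \<Sum>h\<in>indices ns. \<Sum>k<q. ?t i k j h)"
    by (intro sum.cong refl) (rule sum.swap)
  also have "\<dots> = (\<Sum>i<p. \<Sum>j<r. \<Sum>h\<in>indices ns. \<Sum>k<q. ?t i k j h)"
    by (rule sum.swap)
  also have "\<dots> = (\<Sum>is\<in>indices (p # r # ns). ltrans Us Y $$$ is * cnj (ltrans Us (ctprod Us A X) $$$ is))"
    by (simp add: sum_indices_Cons ltrans_ctprod_entry[OF A X] sum_distrib_left mult_ac)
  also have "\<dots> = of_real \<rho> * (\<Sum>is\<in>indices (p # r # ns). Y $$$ is * cnj (ctprod Us A X $$$ is))"
    by (rule ltrans_parseval[OF Y dims_ctprod[OF A X]])
  finally show ?thesis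
    using rho_pos by simp
qed

lemma cfnorm2_ltrans:
  assumes A: "dims A = p # q # ns"
  shows "cfnorm2 (ltrans Us A) = \<rho> * cfnorm2 A"
proof -
  have "complex_of_real (cfnorm2 B) = (\<Sum>is\<in>indices (dims B). B $$$ is * cnj (B $$$ is))" for B
    by (simp only: cfnorm2_def of_real_sum complex_norm_square)
  then have "complex_of_real (cfnorm2 (ltrans Us A)) = of_real (\<rho> * cfnorm2 A)"
    using ltrans_parseval[OF A A] by (simp add: A dims_ltrans[OF A])
  then show ?thesis by (simp only: of_real_eq_iff)
qed

lemma cfnorm2_slicewise:
  assumes "dims A = p # q # ns"
  shows "cfnorm2 A = (\<Sum>h\<in>indices ns. \<Sum>i<p. \<Sum>j<q. (cmod (A $$$ (i # j # h)))\<^sup>2)"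
proof -
  have "cfnorm2 A = (\<Sum>i<p. \<Sum>j<q. \<Sum>h\<in>indices ns. (cmod (A $$$ (i # j # h)))\<^sup>2)"
    by (simp add: cfnorm2_def assms sum_indices_Cons)
  also have "\<dots> = (\<Sum>i<p. \<Sum>h\<in>indices ns. \<Sum>j<q. (cmod (A $$$ (i # j # h)))\<^sup>2)"
    by (intro sum.cong refl) (rule sum.swap)
  also have "\<dots> = (\<Sum>h\<in>indices ns. \<Sum>i<p. \<Sum>j<q. (cmod (A $$$ (i # j # h)))\<^sup>2)"
    by (rule sum.swap)
  finally show ?thesis .
qed

lemma cfnorm2_cconj_transpose:
  assumes A: "dims A = p # q # ns"
  shows "cfnorm2 (cconj_transpose Us A) = cfnorm2 A"
proof -
  note C = dims_cconj_transpose[OF A]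
  have "\<rho> * cfnorm2 (cconj_transpose Us A) = cfnorm2 (ltrans Us (cconj_transpose Us A))"
    by (rule cfnorm2_ltrans[symmetric, OF C])
  also have "\<dots> = (\<Sum>h\<in>indices ns. \<Sum>k<q. \<Sum>i<p. (cmod (ltrans Us A $$$ (i # k # h)))\<^sup>2)"
    by (simp add: cfnorm2_slicewise[OF dims_ltrans[OF C]] ltrans_cconj_transpose_entry[OF A])
  also have "\<dots> = (\<Sum>h\<in>indices ns. \<Sum>i<p. \<Sum>k<q. (cmod (ltrans Us A $$$ (i # k # h)))\<^sup>2)"
    by (rule sum.cong[OF refl], rule sum.swap)
  also have "\<dots> = cfnorm2 (ltrans Us A)"
    by (rule cfnorm2_slicewise[symmetric, OF dims_ltrans[OF A]])
  also have "\<dots> = \<rho> * cfnorm2 A"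
    by (rule cfnorm2_ltrans[OF A])
  finally show ?thesis
    using rho_pos by simp
qed

end

lemma cmod_sum_mult_squared_le:
  fixes a b :: "'i \<Rightarrow> complex"
  shows "(cmod (\<Sum>k\<in>K. a k * b k))\<^sup>2 \<le> (\<Sum>k\<in>K. (cmod (a k))\<^sup>2) * (\<Sum>k\<in>K. (cmod (b k))\<^sup>2)"
proof -
  have "cmod (\<Sum>k\<in>K. a k * b k) \<le> (\<Sum>k\<in>K. cmod (a k) * cmod (b k))"
    by (intro order_trans[OF norm_sum]) (simp add: norm_mult)
  then have "(cmod (\<Sum>k\<in>K. a k * b k))\<^sup>2 \<le> (\<Sum>k\<in>K. cmod (a k) * cmod (b k))\<^sup>2"
    by (intro power_mono) auto
  also have "\<dots> \<le> (\<Sum>k\<in>K. (cmod (a k))\<^sup>2) * (\<Sum>k\<in>K. (cmod (b k))\<^sup>2)"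
    by (rule Cauchy_Schwarz_ineq_sum)
  finally show ?thesis .
qed

lemma sum_mult_le_mult_sum:
  fixes x y :: "'i \<Rightarrow> real"
  assumes "finite H" "\<And>h. h \<in> H \<Longrightarrow> x h \<ge> 0" "\<And>h. h \<in> H \<Longrightarrow> y h \<ge> 0"
  shows "(\<Sum>h\<in>H. x h * y h) \<le> (\<Sum>h\<in>H. x h) * (\<Sum>h\<in>H. y h)"
  unfolding sum_distrib_right
  using assms by (intro sum_mono mult_left_mono member_le_sum) auto

context scaled_unitary_transform
begin

text \<open>The Frobenius norm of matrices is submultiplicative on every slice in the transform domain; the
  constant \<open>\<rho>\<close> is what remains of the three applications of Parseval's identity.\<close>

lemma cfnorm2_ctprod_le:
  assumes A: "dims A = p # q # ns" and B: "dims B = q # r # ns"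
  shows "cfnorm2 (ctprod Us A B) \<le> \<rho> * cfnorm2 A * cfnorm2 B"
proof -
  let ?a = "\<lambda>h i k. (cmod (ltrans Us A $$$ (i # k # h)))\<^sup>2"
  let ?b = "\<lambda>h k j. (cmod (ltrans Us B $$$ (k # j # h)))\<^sup>2"
  have slice: "(\<Sum>i<p. \<Sum>j<r. (cmod (\<Sum>k<q. ltrans Us A $$$ (i # k # h) * ltrans Us B $$$ (k # j # h)))\<^sup>2)
      \<le> (\<Sum>i<p. \<Sum>k<q. ?a h i k) * (\<Sum>k<q. \<Sum>j<r. ?b h k j)" for h
  proof -
    have "(\<Sum>i<p. \<Sum>j<r. (cmod (\<Sum>k<q. ltrans Us A $$$ (i # k # h) * ltrans Us B $$$ (k # j # h)))\<^sup>2)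
        \<le> (\<Sum>i<p. \<Sum>j<r. (\<Sum>k<q. ?a h i k) * (\<Sum>k<q. ?b h k j))"
      by (intro sum_mono cmod_sum_mult_squared_le)
    also have "\<dots> = (\<Sum>i<p. \<Sum>k<q. ?a h i k) * (\<Sum>j<r. \<Sum>k<q. ?b h k j)"
      by (rule sum_product[symmetric])
    also have "(\<Sum>j<r. \<Sum>k<q. ?b h k j) = (\<Sum>k<q. \<Sum>j<r. ?b h k j)"
      by (rule sum.swap)
    finally show ?thesis .
  qed
  have "\<rho> * cfnorm2 (ctprod Us A B) = cfnorm2 (ltrans Us (ctprod Us A B))"
    by (rule cfnorm2_ltrans[symmetric, OF dims_ctprod[OF A B]])
  also have "\<dots> = (\<Sum>h\<in>indices ns. \<Sum>i<p. \<Sum>j<r.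
      (cmod (\<Sum>k<q. ltrans Us A $$$ (i # k # h) * ltrans Us B $$$ (k # j # h)))\<^sup>2)"
    by (simp add: cfnorm2_slicewise[OF dims_ltrans[OF dims_ctprod[OF A B]]] ltrans_ctprod_entry[OF A B])
  also have "\<dots> \<le> (\<Sum>h\<in>indices ns. (\<Sum>i<p. \<Sum>k<q. ?a h i k) * (\<Sum>k<q. \<Sum>j<r. ?b h k j))"
    by (intro sum_mono slice)
  also have "\<dots> \<le> (\<Sum>h\<in>indices ns. \<Sum>i<p. \<Sum>k<q. ?a h i k) * (\<Sum>h\<in>indices ns. \<Sum>k<q. \<Sum>j<r. ?b h k j)"
    by (intro sum_mult_le_mult_sum) (auto intro!: sum_nonneg)
  also have "\<dots> = cfnorm2 (ltrans Us A) * cfnorm2 (ltrans Us B)"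
    by (simp add: cfnorm2_slicewise[OF dims_ltrans[OF A]] cfnorm2_slicewise[OF dims_ltrans[OF B]])
  also have "\<dots> = \<rho> * (\<rho> * cfnorm2 A * cfnorm2 B)"
    by (simp add: cfnorm2_ltrans[OF A] cfnorm2_ltrans[OF B])
  finally show ?thesis
    using rho_pos by simp
qed

end

section \<open>The t-product of real tensors\<close>

text \<open>Inner products with unit tensors are the entries.\<close>

lemma tensor_eqI_tinner:
  assumes "dims A = ds" "dims B = ds" and tinner: "\<And>X. dims X = ds \<Longrightarrow> tinner A X = tinner B X"
  shows "A = B"
proof (rule tensor_eqI)
  show "dims A = dims B" using assms by simp
  fix "is" assume is_in: "is \<in> indices (dims A)"
  have "tinner C (tensor ds (\<lambda>js. if js = is then 1 else 0)) = C $$$ is" if "dims C = ds" for C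
    using is_in that assms by (simp add: tinner_def if_distrib[of "\<lambda>x. _ * x"] cong: if_cong)
  then show "A $$$ is = B $$$ is"
    using tinner[of "tensor ds (\<lambda>js. if js = is then 1 else 0)"] assms by simp
qed

lemma of_real_tinner:
  assumes "dims B = dims A"
  shows "complex_of_real (tinner A B)
    = (\<Sum>is\<in>indices (dims A). cplx A $$$ is * cnj (cplx B $$$ is))"
  using assms by (simp add: tinner_def)

locale real_scaled_unitary_transform = scaled_unitary_transform +
  assumes real_closed: "real_closed Us"
begin

lemma map_dim_row_Us: "map dim_row Us = ns"
  using length_Us Us_carrier by (intro nth_equalityI) auto

context
  fixes p q r :: nat and A B :: "real tensor"
  assumes A: "dims A = p # q # ns" and B: "dims B = q # r # ns"
begin

lemma dims_tprod: "dims (tprod Us A B) = p # r # ns"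
  unfolding tprod_def dims_tensor_ops by (rule dims_ctprod) (simp_all add: A B)

lemma cplx_tprod: "cplx (tprod Us A B) = ctprod Us (cplx A) (cplx B)"
proof (rule tensor_eqI)
  have d: "dims (ctprod Us (cplx A) (cplx B)) = p # r # ns"
    by (rule dims_ctprod) (simp_all add: A B)
  then show "dims (cplx (tprod Us A B)) = dims (ctprod Us (cplx A) (cplx B))"
    by (simp add: dims_tprod)
  fix "is" assume "is \<in> indices (dims (cplx (tprod Us A B)))"
  then have is_in: "is \<in> indices (p # r # ns)"
    by (simp add: dims_tprod)
  then have "ctprod Us (cplx A) (cplx B) $$$ is \<in> \<real>"
    using real_closed A B unfolding real_closed_def map_dim_row_Us mem_carrier_tensor by blast
  then show "cplx (tprod Us A B) $$$ is = ctprod Us (cplx A) (cplx B) $$$ is"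
    using is_in by (simp add: dims_tprod) (simp add: tprod_def d)
qed

end

lemma tprod_entry:
  assumes A: "dims A = p # q # ns" and B: "dims B = q # r # ns"
    and "i < p" "j < r" "is \<in> indices ns"
  shows "tprod Us A B $$$ (i # j # is) = Re (tube_inv (\<lambda>hs. \<Sum>k<q.
    tube_trans (\<lambda>is. of_real (A $$$ (i # k # is))) hs * tube_trans (\<lambda>is. of_real (B $$$ (k # j # is))) hs) is)"
proof -
  have cA: "dims (cplx A) = p # q # ns" and cB: "dims (cplx B) = q # r # ns"
    using A B by simp_all
  have "tprod Us A B $$$ (i # j # is) = Re (ctprod Us (cplx A) (cplx B) $$$ (i # j # is))"
    using assms dims_ctprod[OF cA cB] by (simp add: tprod_def)
  also have "ctprod Us (cplx A) (cplx B) $$$ (i # j # is) = tube_inv (\<lambda>hs. \<Sum>k<q.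
      tube_trans (\<lambda>is. cplx A $$$ (i # k # is)) hs * tube_trans (\<lambda>is. cplx B $$$ (k # j # is)) hs) is"
    by (rule ctprod_entry[OF cA cB assms(3-5)])
  also have "\<dots> = tube_inv (\<lambda>hs. \<Sum>k<q. tube_trans (\<lambda>is. of_real (A $$$ (i # k # is))) hs
      * tube_trans (\<lambda>is. of_real (B $$$ (k # j # is))) hs) is"
    using assms by (simp cong: tube_inv_cong tube_trans_cong)
  finally show ?thesis .
qed

lemma cplx_add_smult: "dims B = dims A \<Longrightarrow> cplx (A + c \<cdot>\<^sub>T B) = cplx A + of_real c \<cdot>\<^sub>T cplx B"
  by (rule tensor_eqI) simp_all

lemma tprod_add_smult_right:
  assumes A: "dims A = p # q # ns" and B: "dims B = q # r # ns" and B': "dims B' = q # r # ns"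
  shows "tprod Us A (B + c \<cdot>\<^sub>T B') = tprod Us A B + c \<cdot>\<^sub>T tprod Us A B'"
proof -
  have cA: "dims (cplx A) = p # q # ns" and cB: "dims (cplx B) = q # r # ns"
    and cB': "dims (cplx B') = q # r # ns"
    using A B B' by simp_all
  show ?thesis
    by (rule tensor_eqI)
      (simp_all add: tprod_def cplx_add_smult B B' ctprod_add_smult_right[OF cA cB cB']
        dims_ctprod[OF cA cB] dims_ctprod[OF cA cB'])
qed

lemma tprod_diff_right:
  assumes "dims A = p # q # ns" "dims B = q # r # ns" "dims B' = q # r # ns"
  shows "tprod Us A (B - B') = tprod Us A B - tprod Us A B'"
proof -
  have diff: "C - C' = C + (- 1) \<cdot>\<^sub>T C'" if "dims C' = dims C" for C C' :: "real tensor"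
    by (rule tensor_eqI) (simp_all add: that)
  show ?thesis
    using assms by (simp add: diff tprod_add_smult_right dims_tprod)
qed

lemma dims_conj_transpose:
  assumes "dims A = p # q # ns"
  shows "dims (conj_transpose Us A) = q # p # ns"
  unfolding conj_transpose_def dims_tensor_ops
  by (rule dims_cconj_transpose) (simp add: assms)

text \<open>Taking real parts in the definition of the transpose has no effect on products with real tensors.
  The product with the complex transpose is real, since its entries are inner products of a
  real tensor with products of real tensors. Split the transpose into its real and imaginary parts:
  both have real products with real tensors, so the imaginary part does not contribute.\<close>

lemma cplx_tprod_conj_transpose:
  assumes A: "dims A = p # q # ns" and Y: "dims Y = p # r # ns"
  shows "cplx (tprod Us (conj_transpose Us A) Y) = ctprod Us (cconj_transpose Us (cplx A)) (cplx Y)"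
proof -
  let ?C = "cconj_transpose Us (cplx A)"
  let ?I = "map_tensor Im ?C"
  have cA: "dims (cplx A) = p # q # ns" and cY: "dims (cplx Y) = p # r # ns"
    using A Y by simp_all
  have C: "dims ?C = q # p # ns"
    by (rule dims_cconj_transpose[OF cA])
  have R: "dims (conj_transpose Us A) = q # p # ns"
    by (rule dims_conj_transpose[OF A])
  have CY: "dims (ctprod Us ?C (cplx Y)) = q # r # ns"
    by (rule dims_ctprod[OF C cY])
  have real: "Im (ctprod Us ?C (cplx Y) $$$ is) = 0" if is_in: "is \<in> indices (q # r # ns)" for "is"
  proof -
    define X :: "real tensor" where "X = tensor (q # r # ns) (\<lambda>js. if js = is then 1 else 0)"
    have X: "dims X = q # r # ns"
      by (simp add: X_def)
    have cX: "dims (cplx X) = q # r # ns"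
      by (simp add: X)
    have "ctprod Us ?C (cplx Y) $$$ is
        = (\<Sum>js\<in>indices (q # r # ns). if js = is then ctprod Us ?C (cplx Y) $$$ js else 0)"
      using is_in by simp
    also have "\<dots> = (\<Sum>js\<in>indices (q # r # ns). ctprod Us ?C (cplx Y) $$$ js * cnj (cplx X $$$ js))"
      by (rule sum.cong) (auto simp: X_def)
    also have "\<dots> = (\<Sum>js\<in>indices (p # r # ns). cplx Y $$$ js * cnj (ctprod Us (cplx A) (cplx X) $$$ js))"
      by (rule ctprod_cconj_transpose_adjoint[OF cA cY cX])
    also have "\<dots> = complex_of_real (tinner Y (tprod Us A X))"
      using of_real_tinner[of "tprod Us A X" Y] by (simp add: Y dims_tprod[OF A X] cplx_tprod[OF A X])
    finally show ?thesis by simp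
  qed
  have split: "?C = cplx (conj_transpose Us A) + \<i> \<cdot>\<^sub>T cplx ?I"
    by (rule tensor_eqI) (simp_all add: conj_transpose_def complex_eq)
  have I: "dims ?I = q # p # ns"
    by (simp add: C)
  have "ctprod Us ?C (cplx Y)
      = ctprod Us (cplx (conj_transpose Us A)) (cplx Y) + \<i> \<cdot>\<^sub>T ctprod Us (cplx ?I) (cplx Y)"
    by (subst split, rule ctprod_add_smult_left) (simp_all add: R C Y)
  then have sum: "ctprod Us ?C (cplx Y)
      = cplx (tprod Us (conj_transpose Us A) Y) + \<i> \<cdot>\<^sub>T cplx (tprod Us ?I Y)"
    by (simp add: cplx_tprod[OF R Y] cplx_tprod[OF I Y])
  show ?thesis
  proof (rule tensor_eqI)
    show "dims (cplx (tprod Us (conj_transpose Us A) Y)) = dims (ctprod Us ?C (cplx Y))"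
      by (simp add: CY dims_tprod[OF R Y])
    fix "is" assume "is \<in> indices (dims (cplx (tprod Us (conj_transpose Us A) Y)))"
    then have is_in: "is \<in> indices (q # r # ns)"
      by (simp add: dims_tprod[OF R Y])
    have "ctprod Us ?C (cplx Y) $$$ is
        = of_real (tprod Us (conj_transpose Us A) Y $$$ is) + \<i> * of_real (tprod Us ?I Y $$$ is)"
      using is_in unfolding sum by (simp add: dims_tprod[OF R Y] dims_tprod[OF I Y])
    then show "cplx (tprod Us (conj_transpose Us A) Y) $$$ is = ctprod Us ?C (cplx Y) $$$ is"
      using is_in real[OF is_in] by (simp add: dims_tprod[OF R Y])
  qed
qed

lemma tprod_conj_transpose_adjoint:
  assumes A: "dims A = p # q # ns" and Y: "dims Y = p # r # ns" and X: "dims X = q # r # ns"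
  shows "tinner (tprod Us (conj_transpose Us A) Y) X = tinner Y (tprod Us A X)"
proof -
  have "complex_of_real (tinner (tprod Us (conj_transpose Us A) Y) X)
      = (\<Sum>is\<in>indices (q # r # ns). ctprod Us (cconj_transpose Us (cplx A)) (cplx Y) $$$ is * cnj (cplx X $$$ is))"
    using of_real_tinner[of X "tprod Us (conj_transpose Us A) Y"]
    by (simp add: X dims_tprod[OF dims_conj_transpose[OF A] Y] cplx_tprod_conj_transpose[OF A Y])
  also have "\<dots> = (\<Sum>is\<in>indices (p # r # ns). cplx Y $$$ is * cnj (ctprod Us (cplx A) (cplx X) $$$ is))"
    by (rule ctprod_cconj_transpose_adjoint) (simp_all add: A Y X)
  also have "\<dots> = complex_of_real (tinner Y (tprod Us A X))"
    using of_real_tinner[of "tprod Us A X" Y] by (simp add: Y dims_tprod[OF A X] cplx_tprod[OF A X])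
  finally show ?thesis by (simp only: of_real_eq_iff)
qed

lemma fnorm_tprod_conj_transpose_le:
  assumes A: "dims A = p # q # ns" and Y: "dims Y = p # r # ns"
  shows "(fnorm (tprod Us (conj_transpose Us A) Y))\<^sup>2 \<le> \<rho> * (fnorm A)\<^sup>2 * (fnorm Y)\<^sup>2"
proof -
  have cA: "dims (cplx A) = p # q # ns" and cY: "dims (cplx Y) = p # r # ns"
    using A Y by simp_all
  show ?thesis
    using cfnorm2_ctprod_le[OF dims_cconj_transpose[OF cA] cY]
    by (simp add: cplx_tprod_conj_transpose[OF A Y, symmetric] cfnorm2_cconj_transpose[OF cA] cfnorm2_cplx)
qed

end

section \<open>Blocks of horizontal slices\<close>

lemma dims_subtensor [simp]: "dims (subtensor A \<tau>) = card \<tau> # tl (dims A)"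
  by (simp add: subtensor_def)

lemma nth_sorted_list_of_set_mem:
  assumes "finite \<tau>" "a < card \<tau>"
  shows "sorted_list_of_set \<tau> ! a \<in> \<tau>"
  using assms by (metis length_sorted_list_of_set nth_mem set_sorted_list_of_set)

lemma bij_betw_nth_sorted_list_of_set:
  assumes "finite \<tau>"
  shows "bij_betw ((!) (sorted_list_of_set \<tau>)) {..<card \<tau>} \<tau>"
  using assms by (intro bij_betw_nth) auto

lemma subtensor_entry:
  assumes "a < card \<tau>" "is \<in> indices (tl (dims A))"
  shows "subtensor A \<tau> $$$ (a # is) = A $$$ ((sorted_list_of_set \<tau> ! a) # is)"
  using assms by (simp add: subtensor_def)

lemma subtensor_diff:
  assumes "dims A = n # ds" "dims B = n # ds" "finite \<tau>" "\<tau> \<subseteq> {..<n}"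
  shows "subtensor (A - B) \<tau> = subtensor A \<tau> - subtensor B \<tau>"
proof (rule tensor_eqI)
  fix "is" assume "is \<in> indices (dims (subtensor (A - B) \<tau>))"
  then obtain a is' where *: "is = a # is'" "a < card \<tau>" "is' \<in> indices ds"
    using assms by (auto simp: indices_Cons)
  then have "sorted_list_of_set \<tau> ! a < n"
    using nth_sorted_list_of_set_mem assms by blast
  then show "subtensor (A - B) \<tau> $$$ is = (subtensor A \<tau> - subtensor B \<tau>) $$$ is"
    using * assms by (simp add: subtensor_entry)
qed (use assms in simp)

lemma fnorm_subtensor:
  assumes "dims A = n # ds" "finite \<tau>"
  shows "(fnorm (subtensor A \<tau>))\<^sup>2 = (\<Sum>i\<in>\<tau>. \<Sum>is\<in>indices ds. (A $$$ (i # is))\<^sup>2)"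
proof -
  have "(fnorm (subtensor A \<tau>))\<^sup>2
      = (\<Sum>a<card \<tau>. \<Sum>is\<in>indices ds. (A $$$ ((sorted_list_of_set \<tau> ! a) # is))\<^sup>2)"
    using assms by (simp add: fnorm_squared sum_indices_Cons subtensor_entry)
  also have "\<dots> = (\<Sum>i\<in>\<tau>. \<Sum>is\<in>indices ds. (A $$$ (i # is))\<^sup>2)"
    by (rule sum.reindex_bij_betw[OF bij_betw_nth_sorted_list_of_set[OF assms(2)]])
  finally show ?thesis .
qed

lemma sum_fnorm_subtensor_partition:
  assumes "dims A = n # ds" "partition_on {..<n} P"
  shows "(\<Sum>\<tau>\<in>P. (fnorm (subtensor A \<tau>))\<^sup>2) = (fnorm A)\<^sup>2"
proof -
  have fin: "\<forall>\<tau>\<in>P. finite \<tau>"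
    using assms(2) by (auto simp: partition_on_def intro: finite_subset[of _ "{..<n}"])
  have disj: "\<forall>\<tau>\<in>P. \<forall>\<tau>'\<in>P. \<tau> \<noteq> \<tau>' \<longrightarrow> \<tau> \<inter> \<tau>' = {}"
    using assms(2) by (auto simp: partition_on_def disjoint_def)
  have "(\<Sum>\<tau>\<in>P. (fnorm (subtensor A \<tau>))\<^sup>2) = (\<Sum>\<tau>\<in>P. \<Sum>i\<in>\<tau>. \<Sum>is\<in>indices ds. (A $$$ (i # is))\<^sup>2)"
    by (intro sum.cong refl fnorm_subtensor[OF assms(1)] bspec[OF fin])
  also have "\<dots> = (\<Sum>i\<in>\<Union>P. \<Sum>is\<in>indices ds. (A $$$ (i # is))\<^sup>2)"
    by (simp only: sum.Union_disjoint[OF fin disj] comp_def)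
  also have "\<Union>P = {..<n}"
    using assms(2) by (simp add: partition_on_def)
  finally show ?thesis
    by (simp add: fnorm_squared assms(1) sum_indices_Cons)
qed

lemma fnorm_subtensor_le:
  assumes "dims A = n # ds" "\<tau> \<subseteq> {..<n}"
  shows "(fnorm (subtensor A \<tau>))\<^sup>2 \<le> (fnorm A)\<^sup>2"
proof -
  have "finite \<tau>" using assms(2) finite_subset by blast
  then show ?thesis
    unfolding fnorm_subtensor[OF assms(1) \<open>finite \<tau>\<close>] fnorm_squared[of A] assms(1) sum_indices_Cons
    using assms(2) by (intro sum_mono2) (auto intro!: sum_nonneg)
qed

text \<open>The adjoint of restriction to a block: extension by zero slices.\<close>

definition extend_block :: "nat \<Rightarrow> nat set \<Rightarrow> 'a :: zero tensor \<Rightarrow> 'a tensor" where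
  "extend_block n \<tau> Y = tensor (n # tl (dims Y)) (\<lambda>is. if hd is \<in> \<tau>
     then Y $$$ (inv_into {..<card \<tau>} ((!) (sorted_list_of_set \<tau>)) (hd is) # tl is) else 0)"

lemma tinner_extend_block:
  assumes Y: "dims Y = card \<tau> # ds" and V: "dims V = n # ds" and \<tau>: "\<tau> \<subseteq> {..<n}"
  shows "tinner (extend_block n \<tau> Y) V = tinner Y (subtensor V \<tau>)"
proof -
  have fin: "finite \<tau>" using \<tau> finite_subset by blast
  note bij = bij_betw_nth_sorted_list_of_set[OF fin]
  let ?inv = "inv_into {..<card \<tau>} ((!) (sorted_list_of_set \<tau>))"
  have "tinner (extend_block n \<tau> Y) V
      = (\<Sum>i<n. if i \<in> \<tau> then \<Sum>is\<in>indices ds. Y $$$ (?inv i # is) * V $$$ (i # is) else 0)"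
    by (simp add: tinner_def extend_block_def Y sum_indices_Cons) (intro sum.cong, auto)
  also have "\<dots> = (\<Sum>i\<in>\<tau>. \<Sum>is\<in>indices ds. Y $$$ (?inv i # is) * V $$$ (i # is))"
    using \<tau> by (subst sum.inter_restrict[symmetric]) (simp_all add: Int_absorb1)
  also have "\<dots> = (\<Sum>a<card \<tau>. \<Sum>is\<in>indices ds.
      Y $$$ (?inv (sorted_list_of_set \<tau> ! a) # is) * V $$$ (sorted_list_of_set \<tau> ! a # is))"
    by (rule sum.reindex_bij_betw[OF bij, symmetric])
  also have "\<dots> = (\<Sum>a<card \<tau>. \<Sum>is\<in>indices ds. Y $$$ (a # is) * V $$$ (sorted_list_of_set \<tau> ! a # is))"
    using bij by (intro sum.cong refl) (simp add: bij_betw_def inv_into_f_f)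
  also have "\<dots> = tinner Y (subtensor V \<tau>)"
    by (simp add: tinner_def Y V sum_indices_Cons subtensor_entry)
  finally show ?thesis .
qed

context real_scaled_unitary_transform
begin

lemma tprod_subtensor:
  assumes A: "dims A = p # q # ns" and X: "dims X = q # r # ns" and \<tau>: "\<tau> \<subseteq> {..<p}"
  shows "tprod Us (subtensor A \<tau>) X = subtensor (tprod Us A X) \<tau>"
proof (rule tensor3_eqI)
  have fin: "finite \<tau>" using \<tau> finite_subset by blast
  have S: "dims (subtensor A \<tau>) = card \<tau> # q # ns"
    by (simp add: A)
  show "dims (tprod Us (subtensor A \<tau>) X) = card \<tau> # r # ns"
    by (rule dims_tprod[OF S X])
  show "dims (subtensor (tprod Us A X) \<tau>) = card \<tau> # r # ns"
    by (simp add: dims_tprod[OF A X])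
  fix a j "is" assume *: "a < card \<tau>" "j < r" "is \<in> indices ns"
  then have "sorted_list_of_set \<tau> ! a < p"
    using nth_sorted_list_of_set_mem[OF fin] \<tau> by blast
  with * show "tprod Us (subtensor A \<tau>) X $$$ (a # j # is) = subtensor (tprod Us A X) \<tau> $$$ (a # j # is)"
    by (simp add: tprod_entry[OF S X] tprod_entry[OF A X] subtensor_entry A dims_tprod[OF A X]
        cong: tube_trans_cong)
qed

text \<open>A step with a block stays in the row space of the whole tensor: applying the transpose of a block
  is applying the transpose of the whole tensor to the extension by zero, as comparing the inner
  products with an arbitrary tensor shows.\<close>

lemma row_space_add_block:
  assumes A: "dims A = n1 # n2 # ns" and \<tau>: "\<tau> \<subseteq> {..<n1}"
    and Z: "Z \<in> row_space Us l A" and Y: "dims Y = card \<tau> # l # ns"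
  shows "Z + c \<cdot>\<^sub>T tprod Us (conj_transpose Us (subtensor A \<tau>)) Y \<in> row_space Us l A"
proof -
  obtain Y0 where Y0: "dims Y0 = n1 # l # ns" "Z = tprod Us (conj_transpose Us A) Y0"
    using Z A by (auto simp: row_space_def)
  let ?E = "extend_block n1 \<tau> Y"
  have E: "dims ?E = n1 # l # ns"
    by (simp add: extend_block_def Y)
  have S: "dims (subtensor A \<tau>) = card \<tau> # n2 # ns"
    by (simp add: A)
  note CA = dims_conj_transpose[OF A]
  have "tprod Us (conj_transpose Us A) ?E = tprod Us (conj_transpose Us (subtensor A \<tau>)) Y"
  proof (rule tensor_eqI_tinner)
    show "dims (tprod Us (conj_transpose Us A) ?E) = n2 # l # ns"
      by (rule dims_tprod[OF CA E])
    show "dims (tprod Us (conj_transpose Us (subtensor A \<tau>)) Y) = n2 # l # ns"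
      by (rule dims_tprod[OF dims_conj_transpose[OF S] Y])
    fix X :: "real tensor" assume X: "dims X = n2 # l # ns"
    have "tinner (tprod Us (conj_transpose Us A) ?E) X = tinner ?E (tprod Us A X)"
      by (rule tprod_conj_transpose_adjoint[OF A E X])
    also have "\<dots> = tinner Y (subtensor (tprod Us A X) \<tau>)"
      by (rule tinner_extend_block[OF Y dims_tprod[OF A X] \<tau>])
    also have "\<dots> = tinner Y (tprod Us (subtensor A \<tau>) X)"
      by (simp only: tprod_subtensor[OF A X \<tau>])
    also have "\<dots> = tinner (tprod Us (conj_transpose Us (subtensor A \<tau>)) Y) X"
      by (rule tprod_conj_transpose_adjoint[OF S Y X, symmetric])
    finally show "tinner (tprod Us (conj_transpose Us A) ?E) X
      = tinner (tprod Us (conj_transpose Us (subtensor A \<tau>)) Y) X" .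
  qed
  then have "Z + c \<cdot>\<^sub>T tprod Us (conj_transpose Us (subtensor A \<tau>)) Y
      = tprod Us (conj_transpose Us A) (Y0 + c \<cdot>\<^sub>T ?E)"
    by (simp add: Y0 tprod_add_smult_right[OF CA Y0(1) E])
  then show ?thesis
    unfolding row_space_def using A Y0(1) by auto
qed

end

section \<open>Random histories of finite length\<close>

lemma sum_lists_length_Suc:
  "(\<Sum>xs | set xs \<subseteq> P \<and> length xs = Suc k. g xs)
    = (\<Sum>x\<in>P. \<Sum>xs | set xs \<subseteq> P \<and> length xs = k. g (x # xs))"
proof -
  have "inj_on (\<lambda>(xs, x). x # xs) ({xs. set xs \<subseteq> P \<and> length xs = k} \<times> P)"
    by (auto simp: inj_on_def)
  then have "(\<Sum>xs | set xs \<subseteq> P \<and> length xs = Suc k. g xs)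
      = (\<Sum>xs | set xs \<subseteq> P \<and> length xs = k. \<Sum>x\<in>P. g (x # xs))"
    by (simp add: lists_length_Suc_eq sum.reindex sum.cartesian_product case_prod_unfold)
  also have "\<dots> = (\<Sum>x\<in>P. \<Sum>xs | set xs \<subseteq> P \<and> length xs = k. g (x # xs))"
    by (rule sum.swap)
  finally show ?thesis .
qed

text \<open>If one step with a uniformly random choice contracts \<open>V\<close> on average by the factor \<open>c\<close>, then
  \<open>k\<close> steps contract it by \<open>c ^ k\<close>. With the first choice split off, this is an induction over \<open>k\<close>
  that does not involve conditional expectations.\<close>

lemma sum_fold_decay:
  fixes V :: "'s \<Rightarrow> real" and step :: "'p \<Rightarrow> 's \<Rightarrow> 's"
  assumes "I z" "c \<ge> 0"
    and inv: "\<And>z x. I z \<Longrightarrow> x \<in> P \<Longrightarrow> I (step x z)"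
    and decay: "\<And>z. I z \<Longrightarrow> (\<Sum>x\<in>P. V (step x z)) \<le> real (card P) * c * V z"
  shows "(\<Sum>xs | set xs \<subseteq> P \<and> length xs = k. V (fold step xs z)) \<le> (real (card P) * c) ^ k * V z"
  using \<open>I z\<close>
proof (induction k arbitrary: z)
  case 0
  have "{xs. set xs \<subseteq> P \<and> length xs = 0} = {[]}" by auto
  then show ?case by simp
next
  case (Suc k)
  have "(\<Sum>xs | set xs \<subseteq> P \<and> length xs = Suc k. V (fold step xs z))
      = (\<Sum>x\<in>P. \<Sum>xs | set xs \<subseteq> P \<and> length xs = k. V (fold step xs (step x z)))"
    by (simp only: sum_lists_length_Suc fold_Cons comp_def)
  also have "\<dots> \<le> (\<Sum>x\<in>P. (real (card P) * c) ^ k * V (step x z))"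
    by (intro sum_mono Suc.IH inv Suc.prems)
  also have "\<dots> \<le> (real (card P) * c) ^ k * (real (card P) * c * V z)"
    unfolding sum_distrib_left[symmetric] using \<open>c \<ge> 0\<close> decay[OF Suc.prems]
    by (intro mult_left_mono) auto
  finally show ?case by (simp add: mult_ac)
qed

context prob_space
begin

lemma prob_uniform_history:
  assumes indep: "indep_vars (\<lambda>_. count_space P) T UNIV"
    and unif: "\<And>k. distr M (count_space P) (T k) = uniform_count_measure P"
    and "finite P" and xs: "set xs \<subseteq> P" "length xs = k"
  shows "{\<omega> \<in> space M. map (\<lambda>i. T i \<omega>) [0..<k] = xs} \<in> events"
    and "prob {\<omega> \<in> space M. map (\<lambda>i. T i \<omega>) [0..<k] = xs} = (1 / card P) ^ k"
proof -
  let ?E = "\<lambda>i. T i -` {xs ! i} \<inter> space M"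
  have T: "T i \<in> measurable M (count_space P)" for i
    using indep by (simp add: indep_vars_def2)
  have mem: "xs ! i \<in> P" if "i < k" for i
    using that xs nth_mem by blast
  have E: "?E i \<in> events" and probE: "prob (?E i) = 1 / card P" if "i < k" for i
  proof -
    show "?E i \<in> events"
      by (rule measurable_sets[OF T]) (use mem[OF that] in simp)
    have "prob (?E i) = measure (distr M (count_space P) (T i)) {xs ! i}"
      using measure_distr[OF T, of "{xs ! i}" i] mem[OF that] by simp
    then show "prob (?E i) = 1 / card P"
      using \<open>finite P\<close> mem[OF that] by (simp add: unif measure_uniform_count_measure)
  qed
  have history: "map (\<lambda>i. T i \<omega>) [0..<k] = xs \<longleftrightarrow> (\<forall>i<k. T i \<omega> = xs ! i)" for \<omega>
    using xs(2) by (auto simp: list_eq_iff_nth_eq)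
  have "{\<omega> \<in> space M. map (\<lambda>i. T i \<omega>) [0..<k] = xs} \<in> events
    \<and> prob {\<omega> \<in> space M. map (\<lambda>i. T i \<omega>) [0..<k] = xs} = (1 / card P) ^ k"
  proof (cases "k = 0")
    case True
    then show ?thesis using xs by (simp add: prob_space)
  next
    case False
    then have eq: "{\<omega> \<in> space M. map (\<lambda>i. T i \<omega>) [0..<k] = xs} = (\<Inter>i\<in>{..<k}. ?E i)"
      unfolding history by auto
    have "prob (\<Inter>i\<in>{..<k}. ?E i) = (\<Prod>i<k. prob (?E i))"
      using indep False mem unfolding indep_vars_def2
      by (intro indep_setsD[where I = UNIV and F = "\<lambda>i. {T i -` A \<inter> space M | A. A \<in> sets (count_space P)}"])
        auto
    moreover have "(\<Inter>i\<in>{..<k}. ?E i) \<in> events"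
      using False E by (intro sets.finite_INT) auto
    ultimately show ?thesis
      by (simp add: eq probE)
  qed
  then show "{\<omega> \<in> space M. map (\<lambda>i. T i \<omega>) [0..<k] = xs} \<in> events"
    "prob {\<omega> \<in> space M. map (\<lambda>i. T i \<omega>) [0..<k] = xs} = (1 / card P) ^ k"
    by simp_all
qed

text \<open>A function of finitely many choices from a finite set is a simple function, so that its
  expectation is an average over all histories.\<close>

lemma expectation_uniform_history:
  fixes g :: "'p list \<Rightarrow> real"
  assumes indep: "indep_vars (\<lambda>_. count_space P) T UNIV"
    and unif: "\<And>k. distr M (count_space P) (T k) = uniform_count_measure P"
    and fin: "finite P"
  shows "integrable M (\<lambda>\<omega>. g (map (\<lambda>i. T i \<omega>) [0..<k]))"
    and "expectation (\<lambda>\<omega>. g (map (\<lambda>i. T i \<omega>) [0..<k]))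
      = (\<Sum>xs | set xs \<subseteq> P \<and> length xs = k. g xs) * (1 / card P) ^ k"
proof -
  let ?H = "\<lambda>\<omega>. map (\<lambda>i. T i \<omega>) [0..<k]"
  let ?L = "{xs. set xs \<subseteq> P \<and> length xs = k}"
  let ?E = "\<lambda>xs. {\<omega> \<in> space M. ?H \<omega> = xs}"
  have fin_L: "finite ?L"
    by (rule finite_lists_length_eq[OF fin])
  have T_mem: "T i \<omega> \<in> P" if "\<omega> \<in> space M" for i \<omega>
    using indep that by (auto simp: indep_vars_def2 measurable_def)
  have simple: "g (?H \<omega>) = (\<Sum>xs\<in>?L. g xs * indicator (?E xs) \<omega>)" if "\<omega> \<in> space M" for \<omega>
  proof -
    have "?H \<omega> \<in> ?L"
      using T_mem[OF that] by auto
    then show ?thesis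
      using that fin_L by (simp add: indicator_def if_distrib[of "\<lambda>x. _ * x"] sum.delta' cong: if_cong)
  qed
  have E: "?E xs \<in> events" "prob (?E xs) = (1 / card P) ^ k" if "xs \<in> ?L" for xs
    using prob_uniform_history[OF indep unif fin] that by auto
  have int: "integrable M (\<lambda>\<omega>. \<Sum>xs\<in>?L. g xs * indicator (?E xs) \<omega>)"
    using E(1) by (intro Bochner_Integration.integrable_sum integrable_mult_right) (simp add: integrable_indicator_iff less_top[symmetric])
  show "integrable M (\<lambda>\<omega>. g (?H \<omega>))"
    using int simple by (subst Bochner_Integration.integrable_cong[OF refl simple]) auto
  have "expectation (\<lambda>\<omega>. g (?H \<omega>)) = expectation (\<lambda>\<omega>. \<Sum>xs\<in>?L. g xs * indicator (?E xs) \<omega>)"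
    by (intro Bochner_Integration.integral_cong refl simple)
  also have "\<dots> = (\<Sum>xs\<in>?L. expectation (\<lambda>\<omega>. g xs * indicator (?E xs) \<omega>))"
    using E(1) by (intro Bochner_Integration.integral_sum integrable_mult_right) (simp add: integrable_indicator_iff less_top[symmetric])
  also have "\<dots> = (\<Sum>xs\<in>?L. g xs * (1 / card P) ^ k)"
  proof (rule sum.cong[OF refl])
    fix xs assume xs: "xs \<in> ?L"
    have "expectation (\<lambda>\<omega>. g xs * indicator (?E xs) \<omega>) = g xs * prob (?E xs)"
      by (simp add: Int_absorb2)
    then show "expectation (\<lambda>\<omega>. g xs * indicator (?E xs) \<omega>) = g xs * (1 / card P) ^ k"
      by (simp only: E(2)[OF xs])
  qed
  finally show "expectation (\<lambda>\<omega>. g (?H \<omega>)) = (\<Sum>xs\<in>?L. g xs) * (1 / card P) ^ k"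
    by (simp add: sum_distrib_right)
qed

end

section \<open>Progress of a Kaczmarz step\<close>

lemma fnorm_minus_commute:
  assumes "dims A = dims B"
  shows "(fnorm (A - B))\<^sup>2 = (fnorm (B - A))\<^sup>2"
  using assms by (simp add: fnorm_squared power2_commute)

context real_scaled_unitary_transform
begin

lemma dims_row_space:
  assumes "dims A = n1 # n2 # ns" "Z \<in> row_space Us l A"
  shows "dims Z = n2 # l # ns"
  using assms dims_tprod[OF dims_conj_transpose[OF assms(1)]] by (auto simp: row_space_def)

context
  fixes n1 n2 l :: nat and A B H :: "real tensor" and lam \<epsilon> t :: real
  assumes A: "dims A = n1 # n2 # ns" and H: "dims H = n2 # l # ns" and AH: "tprod Us A H = B"
    and lam: "lam \<ge> 0" and \<epsilon>: "\<epsilon> > 0" and lam_less: "lam < \<epsilon>\<^sup>2"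
begin

abbreviation "block_step \<tau> Z \<equiv> kaczmarz_step Us A B t \<tau> Z (prox_lsp lam \<epsilon> Z)"

abbreviation "bregman_error Z \<equiv> bregman (reg_lsp lam \<epsilon>) Z (prox_lsp lam \<epsilon> Z) H"

lemma dims_B: "dims B = n1 # l # ns"
  using dims_tprod[OF A H] AH by simp

lemma row_space_block_step:
  assumes Z: "Z \<in> row_space Us l A" and \<tau>: "\<tau> \<subseteq> {..<n1}"
  shows "block_step \<tau> Z \<in> row_space Us l A"
  unfolding kaczmarz_step_def
  by (rule row_space_add_block[OF A \<tau> Z]) (simp add: dims_B)

text \<open>The step is a negative multiple of the gradient of \<open>X \<mapsto> \<parallel>A(\<tau>) X - B(\<tau>)\<parallel>\<^sup>2 / 2\<close>. Up to
  scaling, its inner product with the error is therefore minus the squared block residual, which also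
  bounds its squared norm. The first contributes linearly in \<open>t\<close>, the second quadratically.\<close>

lemma bregman_error_block_step:
  assumes Z: "dims Z = n2 # l # ns" and \<tau>: "\<tau> \<subseteq> {..<n1}" and N: "fnorm (subtensor A \<tau>) \<noteq> 0"
  shows "bregman_error (block_step \<tau> Z) \<le> bregman_error Z
    - t / (fnorm (subtensor A \<tau>))\<^sup>2 * (1 - t * \<rho> / (2 * (1 - lam / \<epsilon>\<^sup>2)))
      * (fnorm (subtensor (tprod Us A (prox_lsp lam \<epsilon> Z - H)) \<tau>))\<^sup>2"
proof -
  have fin: "finite \<tau>" using \<tau> finite_subset by blast
  let ?f = "reg_lsp lam \<epsilon>" and ?\<sigma> = "1 - lam / \<epsilon>\<^sup>2" and ?S = "subtensor A \<tau>"
  define X where "X = prox_lsp lam \<epsilon> Z"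
  define R where "R = subtensor B \<tau> - tprod Us ?S X"
  define G where "G = t \<cdot>\<^sub>T tprod Us (conj_transpose Us ?S) ((1 / (fnorm ?S)\<^sup>2) \<cdot>\<^sub>T R)"
  have step: "kaczmarz_step Us A B t \<tau> Z X = Z + G"
    by (simp add: kaczmarz_step_def R_def G_def)
  have \<sigma>: "?\<sigma> > 0"
    using lam_less \<epsilon> by simp
  have S: "dims ?S = card \<tau> # n2 # ns"
    by (simp add: A)
  have X: "dims X = n2 # l # ns"
    by (simp add: X_def Z lam \<epsilon>)
  have XH: "dims (X - H) = n2 # l # ns"
    by (simp add: X)
  have R: "dims R = card \<tau> # l # ns"
    by (simp add: R_def dims_B)
  then have R': "dims ((1 / (fnorm ?S)\<^sup>2) \<cdot>\<^sub>T R) = card \<tau> # l # ns"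
    by simp
  have G: "dims G = n2 # l # ns"
    by (simp add: G_def dims_tprod[OF dims_conj_transpose[OF S] R'])
  have "tprod Us ?S (X - H) = subtensor (tprod Us A X - B) \<tau>"
    by (simp add: tprod_subtensor[OF A XH \<tau>] tprod_diff_right[OF A X H] AH)
  then have residual: "tprod Us ?S (X - H) = tprod Us ?S X - subtensor B \<tau>"
    by (simp add: subtensor_diff[OF dims_tprod[OF A X] dims_B fin \<tau>] tprod_subtensor[OF A X \<tau>])
  have "tinner R (tprod Us ?S (X - H)) = - (fnorm R)\<^sup>2"
    unfolding residual tinner_def fnorm_squared R sum_negf[symmetric]
    by (intro sum.cong refl)
      (simp add: R_def dims_B dims_tprod[OF S X] power2_eq_square algebra_simps)
  then have linear: "tinner G (X - H) = - (t / (fnorm ?S)\<^sup>2 * (fnorm R)\<^sup>2)"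
    by (simp add: G_def tinner_smult_left tprod_conj_transpose_adjoint[OF S R' XH])
  have "(fnorm G)\<^sup>2 \<le> t\<^sup>2 * (\<rho> * (fnorm ?S)\<^sup>2 * (fnorm ((1 / (fnorm ?S)\<^sup>2) \<cdot>\<^sub>T R))\<^sup>2)"
    unfolding G_def fnorm_squared_smult[of t]
    by (intro mult_left_mono fnorm_tprod_conj_transpose_le[OF S R']) simp
  also have "\<dots> = t\<^sup>2 * \<rho> / (fnorm ?S)\<^sup>2 * (fnorm R)\<^sup>2"
    unfolding fnorm_squared_smult using N by (simp add: field_simps power2_eq_square)
  finally have quadratic: "1 / (2 * ?\<sigma>) * (fnorm G)\<^sup>2 \<le> 1 / (2 * ?\<sigma>) * (t\<^sup>2 * \<rho> / (fnorm ?S)\<^sup>2 * (fnorm R)\<^sup>2)"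
    using \<sigma> by (intro mult_left_mono) auto
  have R_norm: "(fnorm (subtensor (tprod Us A (X - H)) \<tau>))\<^sup>2 = (fnorm R)\<^sup>2"
    unfolding tprod_subtensor[OF A XH \<tau>, symmetric] residual R_def
    by (rule fnorm_minus_commute) (simp add: dims_tprod[OF S X] dims_B)
  have "bregman ?f (Z + G) (prox_lsp lam \<epsilon> (Z + G)) H
      \<le> bregman ?f Z X H + tinner G (X - H) + 1 / (2 * ?\<sigma>) * (fnorm G)\<^sup>2"
  proof (rule bregman_perturb_subgradient[OF Z G X _ H \<sigma>])
    show "dims (prox_lsp lam \<epsilon> (Z + G)) = n2 # l # ns"
      by (simp add: Z lam \<epsilon>)
    then show "?f X + tinner Z (prox_lsp lam \<epsilon> (Z + G) - X) + ?\<sigma> / 2 * (fnorm (prox_lsp lam \<epsilon> (Z + G) - X))\<^sup>2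
        \<le> ?f (prox_lsp lam \<epsilon> (Z + G))"
      unfolding X_def
      by (intro reg_lsp_subgradient_quadratic lam \<epsilon> subdiff_prox_lsp) (simp add: Z lam \<epsilon>)
  qed
  also have "\<dots> \<le> bregman ?f Z X H - t / (fnorm ?S)\<^sup>2 * (fnorm R)\<^sup>2
      + 1 / (2 * ?\<sigma>) * (t\<^sup>2 * \<rho> / (fnorm ?S)\<^sup>2 * (fnorm R)\<^sup>2)"
    using linear quadratic by simp
  also have "\<dots> = bregman ?f Z X H - t / (fnorm ?S)\<^sup>2 * (1 - t * \<rho> / (2 * ?\<sigma>)) * (fnorm R)\<^sup>2"
    using \<sigma> N by (simp add: algebra_simps power2_eq_square)
  finally show ?thesis
    by (simp only: X_def[symmetric] step R_norm)
qed

text \<open>Averaged over the partition, the squared block residuals add up to the squared full residual,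
  which the error bound with constant \<open>\<nu>\<close> relates to the Bregman distance. For this, the block norms
  in the coefficients are first replaced by their common upper bound, the norm of \<open>A\<close>.\<close>

lemma sum_bregman_error_block_step:
  assumes Z: "dims Z = n2 # l # ns" and P: "partition_on {..<n1} P"
    and N: "\<forall>\<tau>\<in>P. fnorm (subtensor A \<tau>) \<noteq> 0"
    and "t \<ge> 0" "\<nu> > 0" and c: "1 - t * \<rho> / (2 * (1 - lam / \<epsilon>\<^sup>2)) \<ge> 0"
    and \<nu>: "bregman_error Z \<le> 1 / \<nu> * (fnorm (tprod Us A (prox_lsp lam \<epsilon> Z - H)))\<^sup>2"
  shows "(\<Sum>\<tau>\<in>P. bregman_error (block_step \<tau> Z)) \<le> real (card P) * bregman_error Z
    - \<nu> * t / (fnorm A)\<^sup>2 * (1 - t * \<rho> / (2 * (1 - lam / \<epsilon>\<^sup>2))) * bregman_error Z"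
proof -
  let ?c = "1 - t * \<rho> / (2 * (1 - lam / \<epsilon>\<^sup>2))"
  define V where "V = tprod Us A (prox_lsp lam \<epsilon> Z - H)"
  have V: "dims V = n1 # l # ns"
    unfolding V_def by (rule dims_tprod[OF A]) (simp add: Z lam \<epsilon>)
  have \<tau>: "\<tau> \<subseteq> {..<n1}" if "\<tau> \<in> P" for \<tau>
    using P that by (auto simp: partition_on_def)
  have "(\<Sum>\<tau>\<in>P. bregman_error (block_step \<tau> Z))
      \<le> (\<Sum>\<tau>\<in>P. bregman_error Z - t / (fnorm A)\<^sup>2 * ?c * (fnorm (subtensor V \<tau>))\<^sup>2)"
  proof (rule sum_mono)
    fix \<tau> assume "\<tau> \<in> P"
    note \<tau> = \<tau>[OF this] and N = bspec[OF N this]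
    have "t / (fnorm A)\<^sup>2 \<le> t / (fnorm (subtensor A \<tau>))\<^sup>2"
      using \<open>t \<ge> 0\<close> N fnorm_subtensor_le[OF A \<tau>]
      by (intro divide_left_mono) (auto intro!: mult_pos_pos simp: zero_less_power2 dest: order_less_le_trans[rotated])
    then have "t / (fnorm A)\<^sup>2 * ?c * (fnorm (subtensor V \<tau>))\<^sup>2
        \<le> t / (fnorm (subtensor A \<tau>))\<^sup>2 * ?c * (fnorm (subtensor V \<tau>))\<^sup>2"
      using c by (intro mult_right_mono) auto
    then show "bregman_error (block_step \<tau> Z)
        \<le> bregman_error Z - t / (fnorm A)\<^sup>2 * ?c * (fnorm (subtensor V \<tau>))\<^sup>2"
      using bregman_error_block_step[OF Z \<tau> N] unfolding V_def by linarith
  qed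
  also have "\<dots> = real (card P) * bregman_error Z - t / (fnorm A)\<^sup>2 * ?c * (fnorm V)\<^sup>2"
    unfolding sum_subtractf sum_distrib_left[symmetric] sum_fnorm_subtensor_partition[OF V P] by simp
  also have "\<dots> \<le> real (card P) * bregman_error Z - t / (fnorm A)\<^sup>2 * ?c * (\<nu> * bregman_error Z)"
  proof -
    have "\<nu> * bregman_error Z \<le> (fnorm V)\<^sup>2"
      using \<nu> \<open>\<nu> > 0\<close> by (simp add: V_def field_simps)
    then show ?thesis
      using c \<open>t \<ge> 0\<close> by (intro diff_left_mono mult_left_mono) auto
  qed
  finally show ?thesis by (simp add: mult_ac)
qed

end

end

section \<open>Linear convergence in expectation\<close>

lemma fnorm_eq_0_imp:
  assumes "fnorm A = 0"
  shows "A = zero_tensor (dims A)"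
proof (rule tensor_eqI)
  fix "is" assume is_in: "is \<in> indices (dims A)"
  have "(\<Sum>is\<in>indices (dims A). (A $$$ is)\<^sup>2) = 0"
    using fnorm_squared[of A] assms by simp
  then show "A $$$ is = zero_tensor (dims A) $$$ is"
    using is_in by (simp add: zero_tensor_def sum_nonneg_eq_0_iff)
qed (simp add: zero_tensor_def)

theorem theorem4p1:
  fixes m n1 n2 l M :: nat
    and ns :: "nat list"
    and Us :: "complex mat list"
    and \<rho> lam \<epsilon> t \<nu> :: real
    and A B Xhat Z0 :: "real tensor"
    and P :: "nat set set"
    and \<Omega> :: "'w measure"
    and T :: "nat \<Rightarrow> 'w \<Rightarrow> nat set"
    and Z X :: "nat \<Rightarrow> 'w \<Rightarrow> real tensor"
  assumes m: "m \<ge> 3" "length ns = m - 2"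
    and pos_dims: "n1 > 0" "n2 > 0" "l > 0" "\<forall>n\<in>set ns. n > 0"
    and Us: "length Us = length ns"
      "\<forall>i<length ns. Us ! i \<in> carrier_mat (ns ! i) (ns ! i) \<and> invertible_mat (Us ! i)"
    and rho: "\<rho> > 0"
      "kron_all Us * mat_adjoint (kron_all Us) = of_real \<rho> \<cdot>\<^sub>m 1\<^sub>m (prod_list ns)"
      "mat_adjoint (kron_all Us) * kron_all Us = of_real \<rho> \<cdot>\<^sub>m 1\<^sub>m (prod_list ns)"
    and real_closed: "real_closed Us"
    and A: "A \<in> carrier_tensor (n1 # n2 # ns)"
    and B: "B \<in> carrier_tensor (n1 # l # ns)"
    and solvable: "\<exists>Y\<in>carrier_tensor (n2 # l # ns). tprod Us A Y = B"
    and P: "partition_on {..<n1} P" "card P = M"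
      "\<forall>\<tau>\<in>P. subtensor A \<tau> \<noteq> zero_tensor (card \<tau> # n2 # ns)"
    and params: "lam > 0" "\<epsilon> > 0" "t > 0"
    and Xhat: "is_arg_min (reg_lsp lam \<epsilon>)
      (\<lambda>Y. Y \<in> carrier_tensor (n2 # l # ns) \<and> tprod Us A Y = B) Xhat"
    and standing: "subdiff (reg_lsp lam \<epsilon>) Xhat \<inter> row_space Us l A \<noteq> {}"
    and prob: "prob_space \<Omega>"
    and T_indep: "prob_space.indep_vars \<Omega> (\<lambda>_. count_space P) T UNIV"
    and T_unif: "\<And>k. distr \<Omega> (count_space P) (T k) = uniform_count_measure P"
    and Z0: "Z0 \<in> row_space Us l A"
    and Z_0: "\<And>\<omega>. \<omega> \<in> space \<Omega> \<Longrightarrow> Z 0 \<omega> = Z0"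
    and Z_Suc: "\<And>k \<omega>. \<omega> \<in> space \<Omega> \<Longrightarrow>
      Z (Suc k) \<omega> = kaczmarz_step Us A B t (T k \<omega>) (Z k \<omega>) (X k \<omega>)"
    and X_prox: "\<And>k \<omega>. \<omega> \<in> space \<Omega> \<Longrightarrow> X k \<omega> = prox_lsp lam \<epsilon> (Z k \<omega>)"
    and prox_params: "\<And>k \<omega> is. \<omega> \<in> space \<Omega> \<Longrightarrow> is \<in> indices (n2 # l # ns) \<Longrightarrow>
      (\<bar>Z k \<omega> $$$ is\<bar> + \<epsilon>)\<^sup>2 \<ge> 4 * lam"
    and nu: "\<nu> > 0"
      "\<forall>Y\<in>carrier_tensor (n2 # l # ns). \<forall>W\<in>subdiff (reg_lsp lam \<epsilon>) Y \<inter> row_space Us l A.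
         bregman (reg_lsp lam \<epsilon>) W Y Xhat
           \<le> bregman (reg_lsp lam \<epsilon>) Z0 (prox_lsp lam \<epsilon> Z0) Xhat \<longrightarrow>
         bregman (reg_lsp lam \<epsilon>) W Y Xhat \<le> 1 / \<nu> * (fnorm (tprod Us A (Y - Xhat)))\<^sup>2"
    and lam_eps: "sqrt lam < \<epsilon>"
    and rate: "0 < \<nu> * t / (M * (fnorm A)\<^sup>2) * (1 - t * \<rho> * \<epsilon>\<^sup>2 / (2 * \<epsilon>\<^sup>2 - 2 * lam))"
      "\<nu> * t / (M * (fnorm A)\<^sup>2) * (1 - t * \<rho> * \<epsilon>\<^sup>2 / (2 * \<epsilon>\<^sup>2 - 2 * lam)) < 1"
  shows "\<forall>k. integrable \<Omega> (\<lambda>\<omega>. (fnorm (X k \<omega> - Xhat))\<^sup>2) \<and>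
    prob_space.expectation \<Omega> (\<lambda>\<omega>. (fnorm (X k \<omega> - Xhat))\<^sup>2)
      \<le> (2 * \<epsilon>\<^sup>2 / (\<epsilon>\<^sup>2 - lam) * bregman (reg_lsp lam \<epsilon>) Z0 (prox_lsp lam \<epsilon> Z0) Xhat)
        * (1 - \<nu> * t / (M * (fnorm A)\<^sup>2) * (1 - t * \<rho> * \<epsilon>\<^sup>2 / (2 * \<epsilon>\<^sup>2 - 2 * lam))) ^ k"
proof -
  interpret prob_space \<Omega> by (rule prob)
  interpret real_scaled_unitary_transform Us ns \<rho>
    by standard (use Us rho real_closed in auto)
  let ?V = "\<lambda>W. bregman (reg_lsp lam \<epsilon>) W (prox_lsp lam \<epsilon> W) Xhat"
  define step where "step \<tau> W = kaczmarz_step Us A B t \<tau> W (prox_lsp lam \<epsilon> W)" for \<tau> W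
  define c where "c = 1 - t * \<rho> / (2 * (1 - lam / \<epsilon>\<^sup>2))"
  define q where "q = 1 - \<nu> * t / (M * (fnorm A)\<^sup>2) * c"
  have dims_A: "dims A = n1 # n2 # ns"
    using A by simp
  have dims_Xhat: "dims Xhat = n2 # l # ns" and A_Xhat: "tprod Us A Xhat = B"
    using Xhat by (auto simp: is_arg_min_def)
  have lam: "lam \<ge> 0" and \<epsilon>: "\<epsilon> > 0" and t: "t \<ge> 0"
    using params by simp_all
  have "(sqrt lam)\<^sup>2 < \<epsilon>\<^sup>2"
    using lam_eps lam by (intro power_strict_mono) auto
  then have lam_less: "lam < \<epsilon>\<^sup>2"
    using lam by simp
  have "t * \<rho> * \<epsilon>\<^sup>2 / (2 * \<epsilon>\<^sup>2 - 2 * lam) = t * \<rho> / (2 * (1 - lam / \<epsilon>\<^sup>2))"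
    using \<epsilon> lam_less by (simp add: field_simps)
  then have c_eq: "1 - t * \<rho> * \<epsilon>\<^sup>2 / (2 * \<epsilon>\<^sup>2 - 2 * lam) = c"
    by (simp add: c_def)
  have c_pos: "c > 0"
    using rate(1) nu(1) t unfolding c_eq
    by (smt (verit) divide_nonneg_nonneg mult_nonneg_nonneg of_nat_0_le_iff zero_le_power2 zero_less_mult_iff)
  have M_pos: "M > 0"
    using rate(1) by (cases "M = 0") auto
  have q_nonneg: "q \<ge> 0"
    using rate(2) unfolding c_eq q_def by simp
  have fin_P: "finite P"
    using P(1) by (rule finite_elements[rotated]) simp
  have block: "\<tau> \<subseteq> {..<n1}" if "\<tau> \<in> P" for \<tau>
    using P(1) that by (auto simp: partition_on_def)
  have block_norm: "fnorm (subtensor A \<tau>) \<noteq> 0" if "\<tau> \<in> P" for \<tau>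
    using P(3) that fnorm_eq_0_imp[of "subtensor A \<tau>"] dims_A by auto

  have step_decreases: "?V (step \<tau> W) \<le> ?V W" if "W \<in> row_space Us l A" "\<tau> \<in> P" for W \<tau>
  proof -
    have "0 \<le> t / (fnorm (subtensor A \<tau>))\<^sup>2 * c
        * (fnorm (subtensor (tprod Us A (prox_lsp lam \<epsilon> W - Xhat)) \<tau>))\<^sup>2"
      using t c_pos by simp
    then show ?thesis
      using bregman_error_block_step[OF dims_A dims_Xhat A_Xhat lam \<epsilon> lam_less
          dims_row_space[OF dims_A that(1)] block[OF that(2)] block_norm[OF that(2)], of t]
      unfolding step_def c_def[symmetric] by linarith
  qed
  \<comment> \<open>The error bound with constant \<open>\<nu>\<close> is available only below the initial Bregman distance. The
    distance does not increase along any history, hence this is part of the invariant.\<close>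
  define I where "I W \<longleftrightarrow> W \<in> row_space Us l A \<and> ?V W \<le> ?V Z0" for W
  have I_Z0: "I Z0"
    using Z0 by (simp add: I_def)
  have I_step: "I (step \<tau> W)" if "I W" "\<tau> \<in> P" for W \<tau>
    using that step_decreases[of W \<tau>]
      row_space_block_step[OF dims_A dims_Xhat A_Xhat lam \<epsilon> lam_less, of W \<tau> t] block
    unfolding I_def step_def[symmetric] by force
  have I_history: "I (fold step \<tau>s W)" if "I W" "set \<tau>s \<subseteq> P" for W \<tau>s
    using that by (induction \<tau>s arbitrary: W) (auto intro: I_step)
  have average: "(\<Sum>\<tau>\<in>P. ?V (step \<tau> W)) \<le> real (card P) * q * ?V W" if "I W" for W
  proof -
    have W: "W \<in> row_space Us l A" "?V W \<le> ?V Z0"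
      using that by (simp_all add: I_def)
    have dims_W: "dims W = n2 # l # ns"
      by (rule dims_row_space[OF dims_A W(1)])
    have "?V W \<le> 1 / \<nu> * (fnorm (tprod Us A (prox_lsp lam \<epsilon> W - Xhat)))\<^sup>2"
      using nu(2) W subdiff_prox_lsp[OF lam \<epsilon>, of W] dims_W lam \<epsilon> by auto
    then have "(\<Sum>\<tau>\<in>P. ?V (step \<tau> W)) \<le> real (card P) * ?V W - \<nu> * t / (fnorm A)\<^sup>2 * c * ?V W"
      unfolding step_def c_def using block_norm nu(1) t c_pos
      by (intro sum_bregman_error_block_step[OF dims_A dims_Xhat A_Xhat lam \<epsilon> lam_less dims_W P(1)])
        (auto simp: c_def)
    also have "\<dots> = real (card P) * q * ?V W"
      using M_pos P(2) by (simp add: q_def field_simps)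
    finally show ?thesis .
  qed

  have Z_history: "Z k \<omega> = fold step (map (\<lambda>i. T i \<omega>) [0..<k]) Z0" if "\<omega> \<in> space \<Omega>" for k \<omega>
    by (induction k) (simp_all add: Z_0[OF that] Z_Suc[OF that] X_prox[OF that] step_def)
  define g where "g \<tau>s = (fnorm (prox_lsp lam \<epsilon> (fold step \<tau>s Z0) - Xhat))\<^sup>2" for \<tau>s
  have error_history: "(fnorm (X k \<omega> - Xhat))\<^sup>2 = g (map (\<lambda>i. T i \<omega>) [0..<k])"
    if "\<omega> \<in> space \<Omega>" for k \<omega>
    by (simp only: g_def X_prox[OF that] Z_history[OF that])
  have g_le: "g \<tau>s \<le> 2 * \<epsilon>\<^sup>2 / (\<epsilon>\<^sup>2 - lam) * ?V (fold step \<tau>s Z0)" if "set \<tau>s \<subseteq> P" for \<tau>s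
  proof -
    let ?W = "fold step \<tau>s Z0"
    have "?W \<in> row_space Us l A"
      using I_history[OF I_Z0 that] by (simp add: I_def)
    then have dims_prox: "dims (prox_lsp lam \<epsilon> ?W) = n2 # l # ns"
      using dims_row_space[OF dims_A] lam \<epsilon> by simp
    have "(1 - lam / \<epsilon>\<^sup>2) / 2 * (fnorm (Xhat - prox_lsp lam \<epsilon> ?W))\<^sup>2 \<le> ?V ?W"
      by (rule bregman_reg_lsp_ge[OF lam \<epsilon> subdiff_prox_lsp[OF lam \<epsilon>]]) (simp only: dims_prox dims_Xhat)
    moreover have "g \<tau>s = (fnorm (Xhat - prox_lsp lam \<epsilon> ?W))\<^sup>2"
      unfolding g_def by (rule fnorm_minus_commute) (simp only: dims_prox dims_Xhat)
    moreover have "1 - lam / \<epsilon>\<^sup>2 = (\<epsilon>\<^sup>2 - lam) / \<epsilon>\<^sup>2"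
      using \<epsilon> by (simp add: diff_divide_distrib)
    then have "g \<tau>s = 2 * \<epsilon>\<^sup>2 / (\<epsilon>\<^sup>2 - lam) * ((1 - lam / \<epsilon>\<^sup>2) / 2 * g \<tau>s)"
      using lam_less \<epsilon> by simp
    moreover have "2 * \<epsilon>\<^sup>2 / (\<epsilon>\<^sup>2 - lam) \<ge> 0"
      using lam_less by simp
    ultimately show ?thesis
      by (metis mult_left_mono)
  qed
  show ?thesis
    unfolding c_eq q_def[symmetric]
  proof (intro allI conjI)
    fix k
    note history = expectation_uniform_history[OF T_indep T_unif fin_P, of g k]
    show "integrable \<Omega> (\<lambda>\<omega>. (fnorm (X k \<omega> - Xhat))\<^sup>2)"
      using history(1) by (simp only: error_history cong: Bochner_Integration.integrable_cong)
    let ?L = "{\<tau>s. set \<tau>s \<subseteq> P \<and> length \<tau>s = k}"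
    have "expectation (\<lambda>\<omega>. (fnorm (X k \<omega> - Xhat))\<^sup>2) = (\<Sum>\<tau>s\<in>?L. g \<tau>s) * (1 / card P) ^ k"
      using history(2) by (simp only: error_history cong: Bochner_Integration.integral_cong)
    also have "\<dots> \<le> (\<Sum>\<tau>s\<in>?L. 2 * \<epsilon>\<^sup>2 / (\<epsilon>\<^sup>2 - lam) * ?V (fold step \<tau>s Z0)) * (1 / card P) ^ k"
      by (intro mult_right_mono sum_mono g_le) auto
    also have "\<dots> \<le> 2 * \<epsilon>\<^sup>2 / (\<epsilon>\<^sup>2 - lam) * ((real (card P) * q) ^ k * ?V Z0) * (1 / card P) ^ k"
      unfolding sum_distrib_left[symmetric] using lam_less
      by (intro mult_right_mono mult_left_mono
          sum_fold_decay[where I = I, OF I_Z0 q_nonneg I_step average]) auto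
    also have "\<dots> = 2 * \<epsilon>\<^sup>2 / (\<epsilon>\<^sup>2 - lam) * ?V Z0 * q ^ k"
      using M_pos P(2) by (simp add: power_mult_distrib power_divide)
    finally show "expectation (\<lambda>\<omega>. (fnorm (X k \<omega> - Xhat))\<^sup>2)
      \<le> 2 * \<epsilon>\<^sup>2 / (\<epsilon>\<^sup>2 - lam) * ?V Z0 * q ^ k" .
  qed
qed

end
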